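(* The group pseudo-$F_4$ is isomorphic to the $4$-ary Thompson group $F_4$. Explicitly: let $f_1,f_2,f_3,f_4$ be positive bumps of $[0,1]$ with pairs of feet $L_i,R_i$ ($1\le i\le 4$) such that the eight intervals $L_1,R_1,\ldots,L_4,R_4$ are pairwise disjoint and appear in the left-to-right order $$L_1<L_2<L_3<L_4<R_1<R_3<R_2<R_4 .$$ Then the group $\langle f_1,f_2,f_3,f_4\rangle$ is isomorphic to $F_4$.
   Context: If $f$ is a homeomorphism of $[0,1]$, an *orbital* of $f$ is a maximal open interval on which $f$ has no fixed points. A *bump* is an orientation-preserving homeomorphism of $[0,1]$ with exactly one orbital; it is *positive* if $f(x)\ge x$ for all $x\in[0,1]$. If $f$ is a positive bump with orbital $(a,b)$, a *pair of feet* for $f$ is a pair of intervals $L=(a,c)$, $R=(f(c),b)$ for some chosen $c\in(a,b)$. A set $\{f_1,\ldots,f_n\}$ of positive bumps is *fast* if one can choose a pair of feet $L_i,R_i$ for each $f_i$ so that $L_1,R_1,\ldots,L_n,R_n$ are pairwise disjoint. By a theorem of Bleak, Brin, Kassabov, Moore and Zaremsky, the isomorphism type of $\langle f_1,\ldots,f_n\rangle$ then depends only on the left-to-right order of the feet. *Pseudo-$F_4$* is the (isomorphism type of the) group generated by a fast set of four positive bumps whose feet have the left-to-right order $L_1<L_2<L_3<L_4<R_1<R_3<R_2<R_4$. The *$4$-ary Thompson group $F_4$* is the group of all orientation-preserving piecewise-linear homeomorphisms of $[0,1]$ with finitely many breakpoints, all breakpoints lying in $\mathbb{Z}[1/4]$,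 and all slopes integer powers of $4$. Equivalently, it consists of the homeomorphisms mapping some finite subdivision of $[0,1]$ into standard $4$-adic intervals $[i/4^m,(i+1)/4^m]$ linearly and in order onto another such subdivision. *)

theory Defs
  imports "HOL-Analysis.Analysis" "HOL-Algebra.Bij" "HOL-Algebra.Elementary_Groups"
begin

text \<open>
  Self-maps of $[0,1]$ are functions that are extensional on \<open>{0..1}\<close>, so that they form
  elements of the group \<open>BijGroup {0..1}\<close>, whose multiplication is composition of maps.
\<close>

definition homeo_plus :: "(real \<Rightarrow> real) set" where
  "homeo_plus = {f \<in> Bij {0..1}. (\<exists>g. homeomorphism {0..1} {0..1} f g) \<and> strict_mono_on {0..1} f}"

definition open_interval :: "real set \<Rightarrow> bool" where
  "open_interval I \<longleftrightarrow> (\<exists>a b. 0 \<le> a \<and> a < b \<and> b \<le> 1 \<and> I = {a<..<b})"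

text \<open>
  Elements of \<^const>\<open>homeo_plus\<close> fix 0 and 1, so it is enough to consider intervals
  that are open in the real line.
\<close>

definition orbital :: "(real \<Rightarrow> real) \<Rightarrow> real set \<Rightarrow> bool" where
  "orbital f I \<longleftrightarrow> open_interval I \<and> (\<forall>x\<in>I. f x \<noteq> x) \<and>
     (\<forall>J. open_interval J \<and> (\<forall>x\<in>J. f x \<noteq> x) \<and> I \<subseteq> J \<longrightarrow> J = I)"

definition bump :: "(real \<Rightarrow> real) \<Rightarrow> bool" where
  "bump f \<longleftrightarrow> f \<in> homeo_plus \<and> (\<exists>!I. orbital f I)"

definition positive_bump :: "(real \<Rightarrow> real) \<Rightarrow> bool" where
  "positive_bump f \<longleftrightarrow> bump f \<and> (\<forall>x\<in>{0..1}. x \<le> f x)"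

definition pair_of_feet :: "(real \<Rightarrow> real) \<Rightarrow> real set \<Rightarrow> real set \<Rightarrow> bool" where
  "pair_of_feet f L R \<longleftrightarrow>
     (\<exists>a b c. orbital f {a<..<b} \<and> c \<in> {a<..<b} \<and> L = {a<..<c} \<and> R = {f c<..<b})"

definition left_of :: "real set \<Rightarrow> real set \<Rightarrow> bool" where
  "left_of I J \<longleftrightarrow> (\<forall>x\<in>I. \<forall>y\<in>J. x < y)"

text \<open>The underlying set of the ring $\mathbf{Z}[1/4]$.\<close>

definition Z_quarter :: "real set" where
  "Z_quarter = {of_int i / 4 ^ m | (i :: int) (m :: nat). True}"

text \<open>
  The set \<open>B\<close> contains all breakpoints: \<open>f\<close> is affine, with slope an integer power of 4,
  on every closed interval that has no point of \<open>B\<close> in its interior.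
\<close>

definition thompson_F4_set :: "(real \<Rightarrow> real) set" where
  "thompson_F4_set = {f \<in> homeo_plus. \<exists>B. finite B \<and> B \<subseteq> Z_quarter \<and>
     (\<forall>a b. 0 \<le> a \<and> a < b \<and> b \<le> 1 \<and> {a<..<b} \<inter> B = {} \<longrightarrow>
        (\<exists>(k::int) c. \<forall>x\<in>{a..b}. f x = 4 powi k * x + c))}"

definition thompson_F4 :: "(real \<Rightarrow> real) monoid" where
  "thompson_F4 = (BijGroup {0..1})\<lparr>carrier := thompson_F4_set\<rparr>"

end

theory Submission
  imports Defs
begin

text \<open>
  Both groups are generated by a sequence \<open>x 0, x 1, x 2, \<dots>\<close> of increasing maps with
  \<open>x i \<otimes> x j = x (j + 3) \<otimes> x i\<close> for \<open>i < j\<close>, and in both groups the dynamics shows that no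
  further relations hold.

  In the Thompson group \<open>x i\<close> acts on a row of numbered units by blowing up unit \<open>i\<close> to
  four units. The relation says that blowing up unit \<open>j\<close> first and unit \<open>i < j\<close> later has
  the same effect as doing it in the other order, when unit \<open>j\<close> has become unit \<open>j + 3\<close>.

  To see the same pattern in the other group, suppose that neighbouring feet have no gap between
  them. Then \<open>f 1, \<dots>, f 4\<close> map the left feet onto
  \<open>L1 L2 L3 L4\<close>, \<open>L2 L3 L4 R1 R3\<close>, \<open>L3 L4 R1\<close> and \<open>L4 R1 R3 R2\<close>. These become
  subdivisions into four after regrouping: cut \<open>R1\<close> into \<open>f1 L2\<close> and \<open>f1 f3 L3\<close>, cut \<open>R2\<close>
  into \<open>V = f2 f3 L3\<close> and \<open>W = f2 f3 f4 L4\<close>, and let \<open>U = R1 R3\<close> be a single unit, with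
  parts \<open>f1 L2\<close>, \<open>f1 f3 L3\<close>, \<open>f3 L4\<close> and \<open>f3 U\<close>. Now \<open>L1 L2 L3 L4 U V W R4\<close> is a row of units,
  and the maps that blow up its first four units are
  \<open>f1 f3 f2 f3 f4\<close>, \<open>f2 f3 f4\<close>, \<open>f1 f3 f2 f1\<^sup>-\<^sup>1 f3 f4\<close> and \<open>f4\<close>. They generate the same group as
  the bumps. The relations between these words follow from the inequalities between the ends of the
  feet alone, so that gaps between the feet do no harm (\<open>fast_bumps\<close>).

  The relations bring every positive word into a form with nonincreasing indices and bring every
  group element into the form \<open>inv v \<otimes> w\<close> with positive words \<open>v\<close> and \<open>w\<close>. If different normal forms
  have different values, then the group is determined up to isomorphism
  (\<open>iso_caret_families\<close>). For increasing maps this holds as soon as no \<open>x i\<close> moves a point to the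
  left and there are points \<open>p i\<close> that \<open>x i\<close> moves and all later maps fix: the value at \<open>p i\<close>
  then reveals whether the word ends in \<open>x i\<close> (\<open>separates_normal_formsI\<close>).

  For the Thompson group it remains to show that the maps \<open>x i\<close> generate it
  (\<open>thompson_generated\<close>). An element is affine on a fine uniform subdivision. After changes of
  coordinates in domain and range, which themselves only blow up units by powers of 4, it becomes
  a map that blows up units by powers of 4, and such a map is a positive word
  (\<open>integral_generated\<close>).
\<close>

section \<open>Words with the caret relations\<close>

definition word_prod :: "('a, 'b) monoid_scheme \<Rightarrow> (nat \<Rightarrow> 'a) \<Rightarrow> nat list \<Rightarrow> 'a" where
  "word_prod G x w = foldr (\<lambda>i a. x i \<otimes>\<^bsub>G\<^esub> a) w \<one>\<^bsub>G\<^esub>"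

text \<open>
  A letter passes the larger letters to its right by \<open>x i \<otimes> x j = x (j + 3) \<otimes> x i\<close>. This sorts a
  word into nonincreasing order.
\<close>

fun insert_letter :: "nat \<Rightarrow> nat list \<Rightarrow> nat list" where
  "insert_letter i [] = [i]"
| "insert_letter i (j # w) = (if i < j then (j + 3) # insert_letter i w else i # j # w)"

definition normal_form :: "nat list \<Rightarrow> nat list" where
  "normal_form w = foldr insert_letter w []"

lemma set_insert_letter: "k \<in> set (insert_letter i w) \<Longrightarrow> k = i \<or> (\<exists>j\<in>set w. k \<le> j + 3)"
  by (induction w) (fastforce split: if_splits)+

lemma sorted_insert_letter:
  "sorted_wrt (\<ge>) w \<Longrightarrow> sorted_wrt (\<ge>) (insert_letter i w)"
proof (induction w)
  case (Cons j w)
  then show ?case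
    by (fastforce dest: set_insert_letter)
qed simp

lemma sorted_normal_form: "sorted_wrt (\<ge>) (normal_form w)"
  by (induction w) (auto simp: normal_form_def sorted_insert_letter)

locale caret_family = group G for G (structure) +
  fixes x :: "nat \<Rightarrow> 'a"
  assumes closed [simp]: "x i \<in> carrier G"
    and caret_relation: "i < j \<Longrightarrow> x i \<otimes> x j = x (j + 3) \<otimes> x i"
begin

lemma word_prod_closed [simp]: "word_prod G x w \<in> carrier G"
  by (induction w) (auto simp: word_prod_def)

lemma word_prod_Nil [simp]: "word_prod G x [] = \<one>"
  by (simp add: word_prod_def)

lemma word_prod_Cons [simp]: "word_prod G x (i # w) = x i \<otimes> word_prod G x w"
  by (simp add: word_prod_def)

lemma word_prod_append [simp]:
  "word_prod G x (v @ w) = word_prod G x v \<otimes> word_prod G x w"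
  by (induction v) (auto simp: m_assoc)

lemma word_prod_insert_letter: "word_prod G x (insert_letter i w) = x i \<otimes> word_prod G x w"
proof (induction w)
  case (Cons j w)
  show ?case
  proof (cases "i < j")
    case True
    then show ?thesis
      using Cons by (simp add: caret_relation flip: m_assoc)
  qed simp
qed simp

lemma word_prod_normal_form: "word_prod G x (normal_form w) = word_prod G x w"
  by (induction w) (auto simp: normal_form_def word_prod_insert_letter)

text \<open>
  Common left multiples make products of fractions into fractions. The bound on the length of \<open>B\<close>
  is what lets the induction over words in the next lemma go through: there \<open>B\<close> has to be a single
  letter again.
\<close>

lemma common_multiple_letters:
  "\<exists>A B. length B \<le> 1 \<and> word_prod G x A \<otimes> x i = word_prod G x B \<otimes> x j"
proof -
  consider "i = j" | "i < j" | "j < i" by linarith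
  then show ?thesis
  proof cases
    case 1
    then show ?thesis by (intro exI[of _ "[]"]) simp
  next
    case 2
    then show ?thesis
      by (intro exI[of _ "[j + 3]"] exI[of _ "[i]"]) (simp add: caret_relation)
  next
    case 3
    then show ?thesis
      by (intro exI[of _ "[j]"] exI[of _ "[i + 3]"]) (simp add: caret_relation)
  qed
qed

lemma common_multiple_letter_word:
  "\<exists>A B. length B \<le> 1 \<and> word_prod G x A \<otimes> x i = word_prod G x B \<otimes> word_prod G x w"
proof (induction w arbitrary: i rule: rev_induct)
  case Nil
  show ?case by (intro exI[of _ "[]"] exI[of _ "[i]"]) simp
next
  case (snoc j w)
  obtain A B where AB: "length B \<le> 1" "word_prod G x A \<otimes> x i = word_prod G x B \<otimes> x j"
    using common_multiple_letters by blast
  show ?case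
  proof (cases B)
    case Nil
    then show ?thesis
      using AB by (intro exI[of _ "w @ A"] exI[of _ "[]"]) (simp add: m_assoc)
  next
    case (Cons b B')
    then have b: "word_prod G x A \<otimes> x i = x b \<otimes> x j" using AB by simp
    obtain A' C where C: "length C \<le> 1"
      "word_prod G x A' \<otimes> x b = word_prod G x C \<otimes> word_prod G x w"
      using snoc by blast
    have "word_prod G x (A' @ A) \<otimes> x i = word_prod G x A' \<otimes> (x b \<otimes> x j)"
      by (simp add: m_assoc b)
    also have "\<dots> = word_prod G x C \<otimes> word_prod G x (w @ [j])"
      using C(2) by (simp flip: m_assoc)
    finally show ?thesis using C(1) by blast
  qed
qed

lemma common_multiple_words:
  "\<exists>A B. word_prod G x A \<otimes> word_prod G x v = word_prod G x B \<otimes> word_prod G x w"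
proof (induction v arbitrary: w rule: rev_induct)
  case Nil
  show ?case by (intro exI[of _ w] exI[of _ "[]"]) simp
next
  case (snoc i v)
  obtain A B where AB: "word_prod G x A \<otimes> x i = word_prod G x B \<otimes> word_prod G x w"
    using common_multiple_letter_word by blast
  obtain C D where CD: "word_prod G x C \<otimes> word_prod G x v = word_prod G x D \<otimes> word_prod G x A"
    using snoc by blast
  have "word_prod G x C \<otimes> word_prod G x (v @ [i]) = word_prod G x D \<otimes> (word_prod G x A \<otimes> x i)"
    using CD by (simp flip: m_assoc)
  also have "\<dots> = word_prod G x (D @ B) \<otimes> word_prod G x w"
    by (simp add: AB m_assoc)
  finally show ?case by blast
qed

text \<open>
  In a product of two fractions the inner part \<open>w \<otimes> inv v'\<close> is replaced by
  \<open>inv A \<otimes> B\<close>, where \<open>A @ w\<close> and \<open>B @ v'\<close> have the same value.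
\<close>

lemma generate_fraction:
  assumes "g \<in> generate G (range x)"
  shows "\<exists>v w. g = inv (word_prod G x v) \<otimes> word_prod G x w"
  using assms
proof (induction rule: generate.induct)
  case one
  show ?case by (intro exI[of _ "[]"]) simp
next
  case (incl h)
  then obtain i where "h = x i" by auto
  then show ?case by (intro exI[of _ "[]"] exI[of _ "[i]"]) simp
next
  case (inv h)
  then obtain i where "h = x i" by auto
  then show ?case by (intro exI[of _ "[i]"] exI[of _ "[]"]) simp
next
  case (eng g h)
  then obtain v w v' w' where
    g: "g = inv (word_prod G x v) \<otimes> word_prod G x w" and
    h: "h = inv (word_prod G x v') \<otimes> word_prod G x w'" by blast
  obtain A B where AB: "word_prod G x A \<otimes> word_prod G x w = word_prod G x B \<otimes> word_prod G x v'"
    using common_multiple_words by blast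
  have "word_prod G x w \<otimes> inv (word_prod G x v') = inv (word_prod G x A) \<otimes> word_prod G x B"
  proof -
    have "word_prod G x w = inv (word_prod G x A) \<otimes> (word_prod G x B \<otimes> word_prod G x v')"
      by (metis AB inv_solve_left word_prod_closed m_closed)
    then show ?thesis
      by (simp add: m_assoc)
  qed
  then have "g \<otimes> h = inv (word_prod G x v) \<otimes> (inv (word_prod G x A) \<otimes> word_prod G x B) \<otimes> word_prod G x w'"
    unfolding g h by (simp add: m_assoc flip: m_assoc[of "word_prod G x w"])
  also have "\<dots> = inv (word_prod G x (A @ v)) \<otimes> word_prod G x (B @ w')"
    by (simp add: m_assoc inv_mult_group)
  finally show ?case by blast
qed

end

definition separates_normal_forms :: "('a, 'b) monoid_scheme \<Rightarrow> (nat \<Rightarrow> 'a) \<Rightarrow> bool" where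
  "separates_normal_forms G x \<longleftrightarrow> (\<forall>v w. sorted_wrt (\<ge>) v \<longrightarrow> sorted_wrt (\<ge>) w \<longrightarrow>
     word_prod G x v = word_prod G x w \<longrightarrow> v = w)"

lemma hom_word_prod:
  assumes "caret_family G z" "group H" "h \<in> hom G H"
  shows "h (word_prod G z w) = word_prod H (\<lambda>i. h (z i)) w"
proof -
  interpret caret_family G z by fact
  interpret group_hom G H h
    using assms by (simp add: group_hom_def group_hom_axioms_def is_group)
  show ?thesis
    by (induction w) (auto simp: word_prod_def[of H])
qed

text \<open>
  An element of the kernel is a fraction \<open>inv v \<otimes> w\<close> whose words have the same value under \<open>h\<close>.
  Then \<open>v\<close> and \<open>w\<close> have the same normal form, and this already makes their values in \<open>G\<close> equal.
\<close>

lemma iso_hom_image: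
  assumes "caret_family G z" "group H" "h \<in> hom G H"
    and "separates_normal_forms H (\<lambda>i. h (z i))"
  shows "subgroup_generated G (range z) \<cong> subgroup_generated H (range (\<lambda>i. h (z i)))"
proof -
  interpret caret_family G z by fact
  have G: "group G" by (rule is_group)
  interpret group_hom G H h
    using assms by (simp add: group_hom_def group_hom_axioms_def is_group)
  have sub: "range z \<subseteq> carrier G" and sub': "range (\<lambda>i. h (z i)) \<subseteq> carrier H"
    by auto
  have carrier: "carrier (subgroup_generated G (range z)) = generate G (range z)"
    "carrier (subgroup_generated H (range (\<lambda>i. h (z i)))) = generate H (range (\<lambda>i. h (z i)))"
    using sub sub' by (simp_all add: carrier_subgroup_generated Int_absorb1)
  have img: "h ` generate G (range z) = generate H (range (\<lambda>i. h (z i)))"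
    using generate_img[OF sub] by (simp add: image_image)
  have trivial: "g = \<one>\<^bsub>G\<^esub>" if g: "g \<in> generate G (range z)" "h g = \<one>\<^bsub>H\<^esub>" for g
  proof -
    obtain v w where vw: "g = inv\<^bsub>G\<^esub> (word_prod G z v) \<otimes>\<^bsub>G\<^esub> word_prod G z w"
      using generate_fraction[OF g(1)] by blast
    have "h (word_prod G z v) = h (word_prod G z w)"
      using g(2) unfolding vw
      by simp (metis H.inv_solve_left H.r_one hom_closed word_prod_closed H.one_closed)
    then have "h (word_prod G z (normal_form v)) = h (word_prod G z (normal_form w))"
      by (simp add: word_prod_normal_form)
    then have "normal_form v = normal_form w"
      using assms(4) sorted_normal_form hom_word_prod[OF assms(1-3)]
      unfolding separates_normal_forms_def by metis
    then have "word_prod G z v = word_prod G z w"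
      by (metis word_prod_normal_form)
    then show ?thesis by (simp add: vw)
  qed
  have in_carrier: "g \<in> carrier G" if "g \<in> generate G (range z)" for g
    using group.generate_in_carrier[OF G sub that] .
  have "inj_on h (generate G (range z))"
  proof (rule inj_onI)
    fix g g' assume g: "g \<in> generate G (range z)" "g' \<in> generate G (range z)" "h g = h g'"
    have "g \<otimes>\<^bsub>G\<^esub> inv\<^bsub>G\<^esub> g' \<in> generate G (range z)"
      using g group.generate_m_inv_closed[OF G sub] by (blast intro: generate.eng)
    moreover have "h (g \<otimes>\<^bsub>G\<^esub> inv\<^bsub>G\<^esub> g') = \<one>\<^bsub>H\<^esub>"
      using g in_carrier by simp
    ultimately have "g \<otimes>\<^bsub>G\<^esub> inv\<^bsub>G\<^esub> g' = \<one>\<^bsub>G\<^esub>" by (rule trivial)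
    then show "g = g'" using g in_carrier by (metis G group.inv_equality group.inv_inv group.inv_closed)
  qed
  then have "h \<in> iso (subgroup_generated G (range z)) (subgroup_generated H (range (\<lambda>i. h (z i))))"
    using in_carrier unfolding iso_def bij_betw_def
    by (auto simp: hom_def carrier img simp flip: img)
  then show ?thesis by (rule is_isoI)
qed

lemma hom_fst: "fst \<in> hom (G \<times>\<times> H) G" and hom_snd: "snd \<in> hom (G \<times>\<times> H) H"
  by (auto simp: hom_def mult_DirProd')

text \<open>
  The pairs \<open>(x i, y i)\<close> satisfy the relations in the direct product, so that both projections are
  isomorphisms on the subgroup that they generate.
\<close>

theorem iso_caret_families:
  assumes x: "caret_family G x" and y: "caret_family H y"
    and sep: "separates_normal_forms G x" "separates_normal_forms H y"
  shows "subgroup_generated G (range x) \<cong> subgroup_generated H (range y)"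
proof -
  interpret X: caret_family G x by fact
  interpret Y: caret_family H y by fact
  let ?z = "\<lambda>i. (x i, y i)"
  interpret Z: group "G \<times>\<times> H"
    by (rule DirProd_group[OF X.is_group Y.is_group])
  have z: "caret_family (G \<times>\<times> H) ?z"
    by unfold_locales (auto simp: X.caret_relation Y.caret_relation)
  have "subgroup_generated (G \<times>\<times> H) (range ?z) \<cong> subgroup_generated G (range x)"
    using iso_hom_image[OF z X.is_group hom_fst] sep(1) by simp
  moreover have "subgroup_generated (G \<times>\<times> H) (range ?z) \<cong> subgroup_generated H (range y)"
    using iso_hom_image[OF z Y.is_group hom_snd] sep(2) by simp
  ultimately show ?thesis
    by (meson Z.group_subgroup_generated group.iso_sym iso_trans)
qed

section \<open>Increasing bijections of the unit interval\<close>

abbreviation bij01 :: "(real \<Rightarrow> real) monoid" where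
  "bij01 \<equiv> BijGroup {0..1}"

interpretation bij01: group bij01
  by (rule group_BijGroup)

lemma carrier_bij01: "carrier bij01 = Bij {0..1}"
  by (simp add: BijGroup_def)

lemma Bij01_range: "f \<in> Bij {0..1::real} \<Longrightarrow> t \<in> {0..1} \<Longrightarrow> f t \<in> {0..1}"
  using Bij_imp_funcset by blast

lemma mult_apply:
  "f \<in> Bij {0..1} \<Longrightarrow> g \<in> Bij {0..1} \<Longrightarrow> t \<in> {0..1} \<Longrightarrow> (f \<otimes>\<^bsub>bij01\<^esub> g) t = f (g t)"
  by (simp add: BijGroup_def compose_def)

lemma one_apply: "t \<in> {0..1} \<Longrightarrow> \<one>\<^bsub>bij01\<^esub> t = t"
  by (simp add: BijGroup_def)

lemma mult_Bij: "f \<in> Bij {0..1} \<Longrightarrow> g \<in> Bij {0..1} \<Longrightarrow> f \<otimes>\<^bsub>bij01\<^esub> g \<in> Bij {0..1}"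
  using bij01.m_closed by (simp add: carrier_bij01)

lemma inv_Bij: "f \<in> Bij {0..1} \<Longrightarrow> inv\<^bsub>bij01\<^esub> f \<in> Bij {0..1}"
  using bij01.inv_closed by (simp add: carrier_bij01)

lemma apply_inv: "f \<in> Bij {0..1} \<Longrightarrow> t \<in> {0..1} \<Longrightarrow> f ((inv\<^bsub>bij01\<^esub> f) t) = t"
  using mult_apply[of f "inv\<^bsub>bij01\<^esub> f" t] bij01.r_inv[of f]
  by (simp add: inv_Bij carrier_bij01 one_apply)

lemma inv_apply: "f \<in> Bij {0..1} \<Longrightarrow> t \<in> {0..1} \<Longrightarrow> (inv\<^bsub>bij01\<^esub> f) (f t) = t"
  using mult_apply[of "inv\<^bsub>bij01\<^esub> f" f t] bij01.l_inv[of f]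
  by (simp add: inv_Bij carrier_bij01 one_apply)

lemma Bij01_eqI:
  "f \<in> Bij {0..1} \<Longrightarrow> g \<in> Bij {0..1} \<Longrightarrow> (\<And>t::real. t \<in> {0..1} \<Longrightarrow> f t = g t) \<Longrightarrow> f = g"
  by (rule extensionalityI[of _ "{0..1}"]) (auto simp: Bij_def)

text \<open>
  Continuity is automatic for a monotone bijection, so that only order and bijectivity have to be
  checked later on.
\<close>

lemma homeo_plus_iff: "f \<in> homeo_plus \<longleftrightarrow> f \<in> Bij {0..1} \<and> strict_mono_on {0..1} f"
proof
  assume f: "f \<in> Bij {0..1} \<and> strict_mono_on {0..1} f"
  then have bij: "bij_betw f {0..1} {0..1}" and mono: "strict_mono_on {0..1} f"
    by (auto simp: Bij_def)
  have range: "f t \<in> {0..1}" if "t \<in> {0..1}" for t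
    using bij that by (auto simp: bij_betw_def)
  \<comment> \<open>Extended by the identity, \<open>f\<close> is a monotone surjection of the line, hence continuous.\<close>
  define F where "F t = (if t \<in> {0..1} then f t else t)" for t
  have "F s \<le> F t" if "s \<le> t" for s t
  proof (cases "s \<in> {0..1} \<and> t \<in> {0..1}")
    case True
    then show ?thesis
      using that mono by (auto simp: F_def strict_mono_on_def le_less)
  next
    case False
    then show ?thesis
      using that range[of s] range[of t] by (auto simp: F_def)
  qed
  moreover have "range F = UNIV"
  proof -
    have "u \<in> range F" for u
    proof (cases "u \<in> {0..1}")
      case True
      then obtain t where "t \<in> {0..1}" "f t = u"
        using bij by (metis bij_betw_def imageE)
      then show ?thesis by (auto simp: F_def intro!: image_eqI[of _ _ t])
    next
      case False
      then show ?thesis by (intro image_eqI[of _ _ u]) (auto simp: F_def)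
    qed
    then show ?thesis by blast
  qed
  ultimately have "continuous_on UNIV F"
    by (intro continuous_onI_mono) auto
  then have "continuous_on {0..1} f"
    by (rule continuous_on_eq[OF continuous_on_subset]) (auto simp: F_def)
  then obtain g where "homeomorphism {0..1} {0..1} f g"
    using bij homeomorphism_compact[of "{0..1}" f "{0..1}"] by (auto simp: bij_betw_def)
  then show "f \<in> homeo_plus"
    using f by (auto simp: homeo_plus_def)
qed (auto simp: homeo_plus_def)

lemma homeo_plus_Bij: "f \<in> homeo_plus \<Longrightarrow> f \<in> Bij {0..1}"
  by (simp add: homeo_plus_iff)

lemma homeo_plus_less_iff:
  assumes "f \<in> homeo_plus" "s \<in> {0..1}" "t \<in> {0..1}"
  shows "f s < f t \<longleftrightarrow> s < t"
  using assms unfolding homeo_plus_iff by (auto simp: strict_mono_on_less)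

lemma homeo_plus_le_iff:
  assumes "f \<in> homeo_plus" "s \<in> {0..1}" "t \<in> {0..1}"
  shows "f s \<le> f t \<longleftrightarrow> s \<le> t"
  using homeo_plus_less_iff[OF assms(1,3,2)] by (auto simp: not_less[symmetric])

lemma homeo_plus_endpoints:
  assumes "f \<in> homeo_plus"
  shows "f 0 = 0" "f 1 = 1"
proof -
  have f: "f \<in> Bij {0..1}" using assms by (rule homeo_plus_Bij)
  let ?g = "inv\<^bsub>bij01\<^esub> f"
  have g: "?g t \<in> {0..1}" "f (?g t) = t" if "t \<in> {0..1}" for t
    using that f by (auto simp only: apply_inv intro: Bij01_range inv_Bij)
  have "f 0 \<le> f (?g 0)" "f (?g 1) \<le> f 1"
    using g(1)[of 0] g(1)[of 1] assms by (auto simp: homeo_plus_le_iff)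
  then show "f 0 = 0" "f 1 = 1"
    using g(2)[of 0] g(2)[of 1] Bij01_range[OF f, of 0] Bij01_range[OF f, of 1] by auto
qed

lemma homeo_plus_mult:
  assumes "f \<in> homeo_plus" "g \<in> homeo_plus"
  shows "f \<otimes>\<^bsub>bij01\<^esub> g \<in> homeo_plus"
proof -
  have "(f \<otimes>\<^bsub>bij01\<^esub> g) s < (f \<otimes>\<^bsub>bij01\<^esub> g) t" if "s \<in> {0..1}" "t \<in> {0..1}" "s < t" for s t
    using that assms Bij01_range[of g s] Bij01_range[of g t]
    by (simp add: mult_apply homeo_plus_Bij homeo_plus_less_iff)
  then show ?thesis
    using assms by (auto simp: homeo_plus_iff mult_Bij strict_mono_on_def)
qed

lemma homeo_plus_inv:
  assumes "f \<in> homeo_plus"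
  shows "inv\<^bsub>bij01\<^esub> f \<in> homeo_plus"
proof -
  let ?g = "inv\<^bsub>bij01\<^esub> f"
  have f: "f \<in> Bij {0..1}" using assms by (rule homeo_plus_Bij)
  have "?g s < ?g t" if "s \<in> {0..1}" "t \<in> {0..1}" "s < t" for s t
    using that homeo_plus_less_iff[OF assms, of "?g s" "?g t"] f
      Bij01_range[OF inv_Bij[OF f], of s] Bij01_range[OF inv_Bij[OF f], of t]
    by (simp add: apply_inv)
  then show ?thesis
    using f by (auto simp: homeo_plus_iff inv_Bij strict_mono_on_def)
qed

section \<open>Caret relations and normal forms from dynamics\<close>

text \<open>
  Two equal nonincreasing words have the same last, hence smallest, letter: if \<open>i\<close> is the smaller one
  of their last letters, then a word without \<open>i\<close> fixes \<open>p i\<close>, and the word that ends in \<open>i\<close> moves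
  \<open>p i\<close> to the right. The common last letter can be cancelled.
\<close>

lemma separates_normal_formsI:
  fixes x :: "nat \<Rightarrow> real \<Rightarrow> real" and p :: "nat \<Rightarrow> real"
  assumes "caret_family bij01 x"
    and expands: "\<And>i t. t \<in> {0..1} \<Longrightarrow> t \<le> x i t"
    and p: "\<And>i. p i \<in> {0..1}"
    and moves: "\<And>i. p i < x i (p i)"
    and fixes_p: "\<And>i j. i < j \<Longrightarrow> x j (p i) = p i"
  shows "separates_normal_forms bij01 x"
proof -
  interpret caret_family bij01 x by fact
  have x: "x i \<in> Bij {0..1}" for i using closed by (simp add: carrier_bij01)
  have word: "word_prod bij01 x w \<in> Bij {0..1}" for w
    using word_prod_closed by (simp add: carrier_bij01)
  have ge: "t \<le> word_prod bij01 x w t" if "t \<in> {0..1}" for w t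
  proof (induction w)
    case (Cons i w)
    then show ?case
      using that expands[of "word_prod bij01 x w t" i] Bij01_range[OF word, of t w]
      by (auto simp: mult_apply x word simp del: atLeastAtMost_iff)
  qed (use that in \<open>simp add: one_apply\<close>)
  have fixes_word: "word_prod bij01 x w (p i) = p i" if "\<forall>j\<in>set w. i < j" for w i
    using that p[of i]
    by (induction w) (simp_all add: one_apply mult_apply x word fixes_p del: atLeastAtMost_iff)
  have last: "word_prod bij01 x (v @ [i]) \<noteq> word_prod bij01 x w" if "\<forall>j\<in>set w. i < j" for v w i
  proof -
    have "p i < x i (p i)" by (rule moves)
    also have "\<dots> \<le> word_prod bij01 x v (x i (p i))"
      using x p Bij01_range by (intro ge) blast
    also have "\<dots> = word_prod bij01 x (v @ [i]) (p i)"
      using p[of i] by (simp add: mult_apply x word del: atLeastAtMost_iff)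
    finally show ?thesis using fixes_word[OF that] by auto
  qed
  have "v = w" if "sorted_wrt (\<ge>) v" "sorted_wrt (\<ge>) w"
    "word_prod bij01 x v = word_prod bij01 x w" for v w
    using that
  proof (induction v arbitrary: w rule: rev_induct)
    case Nil
    then show ?case
    proof (cases w rule: rev_cases)
      case (snoc w' j)
      then show ?thesis using last[of "[]" j w'] Nil.prems(3) by simp
    qed simp
  next
    case (snoc i v)
    show ?case
    proof (cases w rule: rev_cases)
      case Nil
      then show ?thesis using last[of "[]"] snoc.prems(3) by simp
    next
      case w: (snoc w' j)
      have "\<forall>k\<in>set (w' @ [j]). j \<le> k" "\<forall>k\<in>set (v @ [i]). i \<le> k"
        using snoc.prems(1,2) w by (auto simp: sorted_wrt_append)
      then have "\<not> i < j" "\<not> j < i"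
        using last[of "w' @ [j]" i v] last[of "v @ [i]" j w'] snoc.prems(3) w
        by (metis order.strict_trans2)+
      then have "i = j" by simp
      moreover have "word_prod bij01 x v = word_prod bij01 x w'"
        using snoc.prems(3) w \<open>i = j\<close> by simp
      ultimately show ?thesis
        using snoc w by (auto simp: sorted_wrt_append)
    qed
  qed
  then show ?thesis by (auto simp: separates_normal_forms_def)
qed

text \<open>
  Conjugation by \<open>x i\<close> and conjugation by \<open>x 0\<close> have the same effect on \<open>x j\<close> if \<open>i < j\<close>, because
  \<open>x i\<close> and \<open>x 0\<close> agree to the right of \<open>p j\<close> and \<open>x j\<close> is the identity to the left of it. So it
  is enough to know how \<open>x 0\<close> conjugates.
\<close>

lemma caret_familyI:
  fixes x :: "nat \<Rightarrow> real \<Rightarrow> real" and p :: "nat \<Rightarrow> real"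
  assumes x: "\<And>i. x i \<in> homeo_plus" and p: "\<And>i. p i \<in> {0..1}" "mono p"
    and shift: "\<And>i. 0 < i \<Longrightarrow> x (i + 3) \<otimes>\<^bsub>bij01\<^esub> x 0 = x 0 \<otimes>\<^bsub>bij01\<^esub> x i"
      "\<And>i. 0 < i \<Longrightarrow> p (i + 3) = x 0 (p i)"
    and fixes_left: "\<And>i t. t \<in> {0..p i} \<Longrightarrow> x i t = t"
    and agree_right: "\<And>i t. t \<in> {p (Suc i)..1} \<Longrightarrow> x i t = x 0 t"
  shows "caret_family bij01 x"
proof unfold_locales
  have Bij: "x i \<in> Bij {0..1}" for i using x by (rule homeo_plus_Bij)
  show "x i \<in> carrier bij01" for i
    using Bij by (simp add: carrier_bij01)
  fix i j :: nat assume "i < j"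
  then have pij: "p (Suc i) \<le> p j" using p(2) by (simp add: mono_def)
  show "x i \<otimes>\<^bsub>bij01\<^esub> x j = x (j + 3) \<otimes>\<^bsub>bij01\<^esub> x i"
  proof (rule Bij01_eqI)
    fix t :: real assume t: "t \<in> {0..1}"
    have j: "x (j + 3) (x 0 t) = x 0 (x j t)"
      using shift(1)[of j] \<open>i < j\<close> mult_apply[OF Bij Bij t] by simp metis
    show "(x i \<otimes>\<^bsub>bij01\<^esub> x j) t = (x (j + 3) \<otimes>\<^bsub>bij01\<^esub> x i) t"
    proof (cases "t \<le> p j")
      case True
      have "x i t \<le> x i (p j)"
        using x t p(1) True by (simp add: homeo_plus_le_iff del: atLeastAtMost_iff)
      also have "\<dots> = p (j + 3)"
        using agree_right[of "p j" i] pij p(1)[of j] shift(2)[of j] \<open>i < j\<close> by simp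
      finally have "x (j + 3) (x i t) = x i t"
        using Bij01_range[OF Bij t] by (intro fixes_left) auto
      then show ?thesis
        using fixes_left[of t j] True t by (simp add: mult_apply Bij)
    next
      case False
      then have "p j \<le> t" by simp
      have "p j = x j (p j)" using fixes_left[of "p j" j] p(1)[of j] by simp
      also have "\<dots> \<le> x j t"
        using x t p(1) \<open>p j \<le> t\<close> by (simp add: homeo_plus_le_iff del: atLeastAtMost_iff)
      finally have "x i (x j t) = x 0 (x j t)"
        using Bij01_range[OF Bij t] pij by (intro agree_right) auto
      moreover have "x i t = x 0 t"
        using t \<open>p j \<le> t\<close> pij by (intro agree_right) auto
      ultimately show ?thesis using t j by (simp add: mult_apply Bij)
    qed
  qed (auto intro: mult_Bij Bij)
qed

text \<open>
  Four maps determine the whole sequence, as \<open>x (j + 3)\<close> is the conjugate of \<open>x j\<close> by \<open>x 0\<close> for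
  \<open>0 < j\<close>. Accordingly the points at which the supports begin are moved on by \<open>x 0\<close>.
\<close>

fun conj_extend :: "(nat \<Rightarrow> real \<Rightarrow> real) \<Rightarrow> nat \<Rightarrow> real \<Rightarrow> real" where
  "conj_extend b j = (if j < 4 then b j
     else b 0 \<otimes>\<^bsub>bij01\<^esub> conj_extend b (j - 3) \<otimes>\<^bsub>bij01\<^esub> inv\<^bsub>bij01\<^esub> b 0)"

fun orbit_extend :: "(real \<Rightarrow> real) \<Rightarrow> (nat \<Rightarrow> real) \<Rightarrow> nat \<Rightarrow> real" where
  "orbit_extend h c j = (if j < 4 then c j else h (orbit_extend h c (j - 3)))"

declare conj_extend.simps [simp del] orbit_extend.simps [simp del]

lemma conj_extend_base: "j < 4 \<Longrightarrow> conj_extend b j = b j"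
  by (simp add: conj_extend.simps)

lemma conj_extend_shift:
  "0 < j \<Longrightarrow> conj_extend b (j + 3) = b 0 \<otimes>\<^bsub>bij01\<^esub> conj_extend b j \<otimes>\<^bsub>bij01\<^esub> inv\<^bsub>bij01\<^esub> b 0"
  by (subst conj_extend.simps) simp

lemma orbit_extend_base: "j < 4 \<Longrightarrow> orbit_extend h c j = c j"
  by (simp add: orbit_extend.simps)

lemma orbit_extend_shift: "0 < j \<Longrightarrow> orbit_extend h c (j + 3) = h (orbit_extend h c j)"
  by (subst orbit_extend.simps) simp

lemma induct_shift3 [case_names base shift]:
  assumes "\<And>j::nat. j < 4 \<Longrightarrow> P j" and "\<And>j. 0 < j \<Longrightarrow> P j \<Longrightarrow> P (j + 3)"
  shows "P j"
proof (induction j rule: less_induct)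
  case (less j)
  show ?case
  proof (cases "j < 4")
    case False
    then show ?thesis
      using assms(2)[of "j - 3"] less[of "j - 3"] by simp
  qed (rule assms(1))
qed

text \<open>
  All conditions are invariant under conjugation by \<open>b 0\<close>, so that they need to be checked only for
  the first four maps.
\<close>

lemma four_carets:
  fixes b :: "nat \<Rightarrow> real \<Rightarrow> real" and c :: "nat \<Rightarrow> real"
  assumes b: "\<And>i. i < 4 \<Longrightarrow> b i \<in> homeo_plus"
    and c: "c 0 = 0" "0 \<le> c 1" "c 1 \<le> c 2" "c 2 \<le> c 3" "c 3 \<le> c 4" "c 4 = b 0 (c 1)" "c 4 \<le> 1"
    and expands: "\<And>i t. i < 4 \<Longrightarrow> t \<in> {0..1} \<Longrightarrow> t \<le> b i t"
    and moves: "\<And>i. i < 4 \<Longrightarrow> c (Suc i) < b i (c (Suc i))"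
    and fixes_left: "\<And>i t. 0 < i \<Longrightarrow> i < 4 \<Longrightarrow> t \<in> {0..c i} \<Longrightarrow> b i t = t"
    and agree_right: "\<And>i t. i < 4 \<Longrightarrow> t \<in> {c (Suc i)..1} \<Longrightarrow> b i t = b 0 t"
  shows "caret_family bij01 (conj_extend b)" "separates_normal_forms bij01 (conj_extend b)"
proof -
  define x where "x = conj_extend b"
  define p where "p = orbit_extend (b 0) c"
  have x_base: "x i = b i" if "i < 4" for i
    using that by (simp add: x_def conj_extend_base)
  have p_base: "p i = c i" if "i < 5" for i
  proof (cases "i < 4")
    case False
    then have "i = 1 + 3" using that by simp
    then show ?thesis
      using orbit_extend_shift[of 1 "b 0" c] c(6) by (simp add: p_def orbit_extend_base)
  qed (simp add: p_def orbit_extend_base)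
  have p_shift: "p (i + 3) = x 0 (p i)" if "0 < i" for i
    using that by (simp add: p_def x_base orbit_extend_shift)
  have b0: "b 0 \<in> Bij {0..1}" using b by (simp add: homeo_plus_Bij)
  have x_homeo: "x i \<in> homeo_plus" for i
  proof (induction i rule: induct_shift3)
    case (shift j)
    then show ?case
      using b[of 0] by (simp add: x_def conj_extend_shift homeo_plus_mult homeo_plus_inv)
  qed (simp add: x_base b)
  then have x_Bij: "x i \<in> Bij {0..1}" for i by (rule homeo_plus_Bij)
  have x_shift: "x (i + 3) (x 0 t) = x 0 (x i t)" if "0 < i" "t \<in> {0..1}" for i t
    using that b0 x_Bij[of i] inv_apply[OF b0] Bij01_range[OF b0] inv_Bij[OF b0]
    by (simp add: x_def conj_extend_shift conj_extend_base mult_apply mult_Bij)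
  have x0_surj: "\<exists>s\<in>{0..1}. t = x 0 s" if "t \<in> {0..1}" for t
    using that x_Bij[of 0] by (auto simp: Bij_def bij_betw_def)
  have p_range: "p i \<in> {0..1}" for i
  proof (induction i rule: induct_shift3)
    case (base j)
    then have "j \<in> {0, 1, 2, 3}" by auto
    then show ?case using c by (auto simp: p_base)
  next
    case (shift j)
    then show ?case using Bij01_range[OF x_Bij] by (simp add: p_shift del: atLeastAtMost_iff)
  qed
  have "p i \<le> p (Suc i)" for i
  proof (induction i rule: induct_shift3)
    case (base j)
    then have "j \<in> {0, 1, 2, 3}" by auto
    then show ?case using c by (auto simp: p_base eval_nat_numeral)
  next
    case (shift j)
    then show ?case
      using p_shift[of j] p_shift[of "Suc j"] p_range x_homeo
      by (simp add: homeo_plus_le_iff del: atLeastAtMost_iff)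
  qed
  then have p_mono: "mono p" by (rule incseq_SucI)
  have x_fixes: "x i t = t" if "t \<in> {0..p i}" for i t
    using that
  proof (induction i arbitrary: t rule: induct_shift3)
    case (base j)
    show ?case
    proof (cases "j = 0")
      case True
      then show ?thesis
        using base c(1) homeo_plus_endpoints(1)[OF x_homeo, of 0] by (simp add: p_base)
    next
      case False
      then show ?thesis using base fixes_left by (simp add: x_base p_base)
    qed
  next
    case (shift j)
    have "t \<in> {0..1}" using shift.prems p_range[of "j + 3"] by auto
    then obtain s where s: "s \<in> {0..1}" "t = x 0 s" using x0_surj by blast
    then have "s \<le> p j"
      using shift p_range homeo_plus_le_iff[OF x_homeo[of 0], of s "p j"]
      by (simp add: p_shift)
    then show ?case using shift s by (simp add: x_shift)
  qed
  have x_agree: "x i t = x 0 t" if "t \<in> {p (Suc i)..1}" for i t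
    using that
  proof (induction i arbitrary: t rule: induct_shift3)
    case (base j)
    then show ?case using agree_right by (simp add: x_base p_base)
  next
    case (shift j)
    have "t \<in> {0..1}" using shift.prems p_range[of "Suc (j + 3)"] by auto
    then obtain s where s: "s \<in> {0..1}" "t = x 0 s" using x0_surj by blast
    have "p (Suc j) \<le> s"
      using shift.prems s p_range homeo_plus_le_iff[OF x_homeo[of 0], of "p (Suc j)" s] p_shift[of "Suc j"]
      by simp
    then show ?case using shift s by (simp add: x_shift)
  qed
  have x_expands: "t \<le> x i t" if "t \<in> {0..1}" for i t
    using that
  proof (induction i arbitrary: t rule: induct_shift3)
    case (base j)
    then show ?case using expands by (simp add: x_base)
  next
    case (shift j)
    obtain s where s: "s \<in> {0..1}" "t = x 0 s" using x0_surj shift by blast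
    then have "x 0 s \<le> x 0 (x j s)"
      using shift x_homeo Bij01_range[OF x_Bij]
      by (simp add: homeo_plus_le_iff del: atLeastAtMost_iff)
    then show ?case using shift s by (simp add: x_shift)
  qed
  have x_moves: "p (Suc i) < x i (p (Suc i))" for i
  proof (induction i rule: induct_shift3)
    case (base j)
    then show ?case using moves by (simp add: x_base p_base)
  next
    case (shift j)
    then have "x 0 (p (Suc j)) < x 0 (x j (p (Suc j)))"
      using x_homeo p_range Bij01_range[OF x_Bij]
      by (simp add: homeo_plus_less_iff del: atLeastAtMost_iff)
    then show ?case using shift p_range p_shift[of "Suc j"] x_shift by simp
  qed
  show caret: "caret_family bij01 (conj_extend b)"
    unfolding x_def[symmetric]
  proof (rule caret_familyI)
    fix i :: nat assume "0 < i"
    then show "x (i + 3) \<otimes>\<^bsub>bij01\<^esub> x 0 = x 0 \<otimes>\<^bsub>bij01\<^esub> x i"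
      by (intro Bij01_eqI) (auto simp: mult_apply mult_Bij x_Bij x_shift)
  qed (use x_homeo p_range p_mono p_shift x_fixes x_agree in auto)
  show "separates_normal_forms bij01 (conj_extend b)"
    unfolding x_def[symmetric]
  proof (rule separates_normal_formsI)
    show "x j (p (Suc i)) = p (Suc i)" if "i < j" for i j
    proof -
      have "p (Suc i) \<le> p j" using that p_mono by (simp add: mono_def)
      then show ?thesis using x_fixes p_range[of "Suc i"] by simp
    qed
  qed (use caret x_expands p_range x_moves in \<open>auto simp: x_def\<close>)
qed

section \<open>Bumps with feet in the given order\<close>

text \<open>
  The orbital of a moved point is bounded by the nearest fixed points on both sides. Thus the only
  orbital of a bump contains all points that are moved.
\<close>

lemma orbital_containing:
  assumes f: "f \<in> homeo_plus" and x: "x \<in> {0..1}" "f x \<noteq> x"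
  shows "\<exists>I. orbital f I \<and> x \<in> I"
proof -
  obtain g where "homeomorphism {0..1} {0..1} f g" using f by (auto simp: homeo_plus_def)
  then have cont: "continuous_on {0..1} f" by (simp add: homeomorphism_def)
  define A where "A = {t \<in> {0..x}. f t = t}"
  define B where "B = {t \<in> {x..1}. f t = t}"
  have "closed A"
    unfolding A_def using x
    by (intro continuous_closed_preimage_constant[where f = "\<lambda>t. f t - t" and a = 0, simplified]
          continuous_intros continuous_on_subset[OF cont]) auto
  moreover have "closed B"
    unfolding B_def using x
    by (intro continuous_closed_preimage_constant[where f = "\<lambda>t. f t - t" and a = 0, simplified]
          continuous_intros continuous_on_subset[OF cont]) auto
  ultimately have "compact A" "compact B"
    using x by (auto simp: compact_eq_bounded_closed A_def B_def
        intro: bounded_subset[OF bounded_closed_interval[of 0 1]])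
  moreover have "0 \<in> A" "1 \<in> B"
    using x homeo_plus_endpoints[OF f] by (auto simp: A_def B_def)
  ultimately obtain a b where a: "a \<in> A" "\<And>t. t \<in> A \<Longrightarrow> t \<le> a" and b: "b \<in> B" "\<And>t. t \<in> B \<Longrightarrow> b \<le> t"
    by (metis compact_attains_sup compact_attains_inf empty_iff)
  have ab: "a \<noteq> x" "b \<noteq> x" using a b x by (auto simp: A_def B_def)
  then have ab': "0 \<le> a" "a < x" "x < b" "b \<le> 1" "f a = a" "f b = b"
    using a(1) b(1) by (auto simp: A_def B_def)
  have nofix: "f t \<noteq> t" if "t \<in> {a<..<b}" for t
    using a(2)[of t] b(2)[of t] that ab' by (cases "t \<le> x") (auto simp: A_def B_def)
  have "orbital f {a<..<b}"
    unfolding orbital_def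
  proof (intro conjI ballI allI impI)
    show "open_interval {a<..<b}" unfolding open_interval_def using ab' by (intro exI[of _ a] exI[of _ b]) simp
    fix J assume J: "open_interval J \<and> (\<forall>x\<in>J. f x \<noteq> x) \<and> {a<..<b} \<subseteq> J"
    then obtain c d where cd: "J = {c<..<d}" by (auto simp: open_interval_def)
    have "x \<in> J" using J ab' by auto
    moreover have "a \<notin> J" "b \<notin> J" using J ab' by blast+
    ultimately have "a \<le> c" "d \<le> b" using cd ab' by auto
    then have "J \<subseteq> {a<..<b}" using cd by auto
    then show "J = {a<..<b}" using J by blast
  qed (use nofix in auto)
  then show ?thesis using ab' by auto
qed

lemma positive_bump_orbital:
  assumes f: "positive_bump f" and orb: "orbital f {a<..<b}" and ab: "a < b"
  shows "f \<in> homeo_plus" "0 \<le> a" "b \<le> 1"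
    and "\<And>t. t \<in> {0..1} \<Longrightarrow> t \<le> f t"
    and "\<And>t. a < t \<Longrightarrow> t < b \<Longrightarrow> t < f t"
    and "\<And>t. t \<in> {0..1} \<Longrightarrow> t \<le> a \<or> b \<le> t \<Longrightarrow> f t = t"
proof -
  show homeo: "f \<in> homeo_plus" and le: "\<And>t. t \<in> {0..1} \<Longrightarrow> t \<le> f t"
    using f by (auto simp: positive_bump_def bump_def)
  obtain a' b' where "0 \<le> a'" "a' < b'" "b' \<le> 1" "{a<..<b} = {a'<..<b'}"
    using orb by (auto simp: orbital_def open_interval_def)
  then show a: "0 \<le> a" and b: "b \<le> 1"
    using ab greaterThanLessThan_subseteq_greaterThanLessThan[of a b a' b'] by auto
  show "t < f t" if "a < t" "t < b" for t
  proof -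
    have "f t \<noteq> t" using orb that by (simp add: orbital_def)
    then show ?thesis using le[of t] that a b by simp
  qed
  show "f t = t" if t: "t \<in> {0..1}" "t \<le> a \<or> b \<le> t" for t
  proof (rule ccontr)
    assume "f t \<noteq> t"
    then obtain I where I: "orbital f I" "t \<in> I" using orbital_containing[OF homeo t(1)] by blast
    have "I = {a<..<b}" using f I(1) orb by (auto simp: positive_bump_def bump_def)
    then show False using I(2) t(2) by auto
  qed
qed

lemma foot_left_of:
  fixes a b :: real
  assumes "left_of {a<..<b} {c<..<d}" "a < b" "c < d"
  shows "b \<le> c"
proof (rule ccontr)
  assume "\<not> b \<le> c"
  then have "c < min b d" "a < b" using assms by auto
  then obtain y where y: "c < y" "y < min b d" using dense by blast
  then have "max a y < b" using assms by simp
  then obtain x where x: "max a y < x" "x < b" using dense by blast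
  then have "x \<in> {a<..<b}" "y \<in> {c<..<d}" using y by auto
  then have "x < y" using assms(1) unfolding left_of_def by blast
  then show False using x by simp
qed

text \<open>
  The left foot of the \<open>i\<close>-th bump begins at \<open>ai\<close>, its right foot ends at \<open>bi\<close>. The right
  end \<open>c\<close> of a left foot is replaced by the left end of the next left foot. It lies at or to the right of
  \<open>c\<close>, so that the bump maps it to or beyond the left end of its right foot, and hence to or beyond
  the ends of the right feet that come before that one; this is \<open>feet\<close>. For \<open>f4\<close> the point \<open>f1 a2\<close>, which
  lies to the right of all left feet, takes the role of the next left end.
\<close>

locale fast_bumps =
  fixes f1 f2 f3 f4 :: "real \<Rightarrow> real"
    and a2 a3 a4 b1 b2 b3 :: real
  assumes homeo: "f1 \<in> homeo_plus" "f2 \<in> homeo_plus" "f3 \<in> homeo_plus" "f4 \<in> homeo_plus"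
    and expands: "t \<in> {0..1} \<Longrightarrow> t \<le> f1 t" "t \<in> {0..1} \<Longrightarrow> t \<le> f2 t"
      "t \<in> {0..1} \<Longrightarrow> t \<le> f3 t" "t \<in> {0..1} \<Longrightarrow> t \<le> f4 t"
    and left: "t \<in> {0..a2} \<Longrightarrow> f2 t = t" "t \<in> {0..a3} \<Longrightarrow> f3 t = t" "t \<in> {0..a4} \<Longrightarrow> f4 t = t"
    and right: "t \<in> {b1..1} \<Longrightarrow> f1 t = t" "t \<in> {b2..1} \<Longrightarrow> f2 t = t" "t \<in> {b3..1} \<Longrightarrow> f3 t = t"
    and order: "0 \<le> a2" "a2 < a3" "a3 < a4" "a4 < f1 a2" "f1 a2 < b1" "b1 \<le> b3" "b3 \<le> b2" "b2 \<le> 1"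
    and feet: "b1 \<le> f3 a4" "b3 \<le> f2 a3" "b2 \<le> f4 (f1 a2)"
    and moves: "a2 < f1 a2" "a3 < f2 a3" "a4 < f3 a4" "f1 a2 < f4 (f1 a2)"
begin

lemma Bij: "f1 \<in> Bij {0..1}" "f2 \<in> Bij {0..1}" "f3 \<in> Bij {0..1}" "f4 \<in> Bij {0..1}"
  using homeo by (simp_all add: homeo_plus_Bij)

text \<open>
  These are the maps that blow up the units \<open>L1\<close>, \<open>L2\<close>, \<open>L3\<close> and \<open>L4\<close> to four units each and
  shift the units further to the right, of which the last ones are absorbed by \<open>R4\<close>.
\<close>

definition base :: "nat \<Rightarrow> real \<Rightarrow> real" where
  "base i = [f1 \<otimes>\<^bsub>bij01\<^esub> f3 \<otimes>\<^bsub>bij01\<^esub> f2 \<otimes>\<^bsub>bij01\<^esub> f3 \<otimes>\<^bsub>bij01\<^esub> f4,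
     f2 \<otimes>\<^bsub>bij01\<^esub> f3 \<otimes>\<^bsub>bij01\<^esub> f4,
     f1 \<otimes>\<^bsub>bij01\<^esub> f3 \<otimes>\<^bsub>bij01\<^esub> f2 \<otimes>\<^bsub>bij01\<^esub> inv\<^bsub>bij01\<^esub> f1 \<otimes>\<^bsub>bij01\<^esub> f3 \<otimes>\<^bsub>bij01\<^esub> f4,
     f4] ! i"

definition point :: "nat \<Rightarrow> real" where
  "point i = [0, a2, a3, a4, f1 a2] ! i"

lemma base_simps:
  "base 0 = f1 \<otimes>\<^bsub>bij01\<^esub> f3 \<otimes>\<^bsub>bij01\<^esub> f2 \<otimes>\<^bsub>bij01\<^esub> f3 \<otimes>\<^bsub>bij01\<^esub> f4"
  "base (Suc 0) = f2 \<otimes>\<^bsub>bij01\<^esub> f3 \<otimes>\<^bsub>bij01\<^esub> f4"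
  "base 2 = f1 \<otimes>\<^bsub>bij01\<^esub> f3 \<otimes>\<^bsub>bij01\<^esub> f2 \<otimes>\<^bsub>bij01\<^esub> inv\<^bsub>bij01\<^esub> f1 \<otimes>\<^bsub>bij01\<^esub> f3 \<otimes>\<^bsub>bij01\<^esub> f4"
  "base 3 = f4"
  by (simp_all add: base_def)

lemma point_simps:
  "point 0 = 0" "point (Suc 0) = a2" "point (Suc (Suc 0)) = a3" "point 2 = a3" "point 3 = a4" "point 4 = f1 a2"
  by (simp_all add: point_def)

lemma range01: 
  assumes "t \<in> {0..1}"
  shows "f1 t \<in> {0..1}" "f2 t \<in> {0..1}" "f3 t \<in> {0..1}" "f4 t \<in> {0..1}"
    "(inv\<^bsub>bij01\<^esub> f1) t \<in> {0..1}"
  using assms Bij01_range Bij inv_Bij by blast+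

lemma base_apply:
  assumes "t \<in> {0..1}"
  shows "base 0 t = f1 (f3 (f2 (f3 (f4 t))))"
    "base (Suc 0) t = f2 (f3 (f4 t))"
    "base 2 t = f1 (f3 (f2 ((inv\<^bsub>bij01\<^esub> f1) (f3 (f4 t)))))"
    "base 3 t = f4 t"
  using assms
  by (simp_all add: base_simps mult_apply mult_Bij inv_Bij Bij range01 del: atLeastAtMost_iff)

lemma less4: "i < 4 \<longleftrightarrow> i = 0 \<or> i = Suc 0 \<or> i = 2 \<or> i = (3::nat)"
  by auto

lemma base_homeo: "i < 4 \<Longrightarrow> base i \<in> homeo_plus"
  by (auto simp: less4 base_simps homeo homeo_plus_mult homeo_plus_inv)

lemma points_range:
  "a2 \<in> {0..1}" "a3 \<in> {0..1}" "a4 \<in> {0..1}" "f1 a2 \<in> {0..1}" "b1 \<in> {0..1}" "b3 \<in> {0..1}" "b2 \<in> {0..1}"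
  using order by auto

text \<open>
  The third map contains \<open>inv f1\<close>, but it is the product of \<open>f3 \<otimes> f4\<close> and a conjugate of
  \<open>f3 \<otimes> f2\<close>, and conjugates of expanding maps are expanding.
\<close>

lemma base_expands:
  assumes "i < 4" and t: "t \<in> {0..1}"
  shows "t \<le> base i t"
proof -
  have 34: "t \<le> f3 (f4 t)" "f3 (f4 t) \<in> {0..1}"
    using expands(4)[of t] expands(3)[of "f4 t"] range01 t by force+
  have 2: "f3 (f4 t) \<le> f2 (f3 (f4 t))" using expands(2) 34 by simp
  have 13: "s \<le> f1 (f3 s)" if "s \<in> {0..1}" for s
    using expands(3)[of s] expands(1)[of "f3 s"] range01 that by force
  let ?s = "(inv\<^bsub>bij01\<^esub> f1) (f3 (f4 t))"
  have s: "?s \<in> {0..1}" using range01 34 by blast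
  have "f3 (f4 t) = f1 ?s" using 34 Bij by (simp add: apply_inv del: atLeastAtMost_iff)
  also have "\<dots> \<le> f1 (f3 (f2 ?s))"
  proof -
    have "?s \<le> f3 (f2 ?s)"
      using expands(2)[of ?s] expands(3)[of "f2 ?s"] range01 s by force
    then show ?thesis using homeo range01 s by (simp add: homeo_plus_le_iff del: atLeastAtMost_iff)
  qed
  finally have "f3 (f4 t) \<le> f1 (f3 (f2 ?s))" .
  moreover have "f2 (f3 (f4 t)) \<le> f1 (f3 (f2 (f3 (f4 t))))"
    using 13 range01 34 by blast
  ultimately show ?thesis
    using assms 34 2 expands(4) by (auto simp: less4 base_apply[OF t])
qed

lemma base_left:
  assumes "0 < i" "i < 4" "t \<in> {0..point i}"
  shows "base i t = t"
proof -
  have t: "t \<in> {0..1}" and i: "i = Suc 0 \<or> i = 2 \<or> i = 3"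
    using assms points_range by (auto simp: less4 point_simps)
  have "base 2 t = t" if "t \<le> a3"
  proof -
    let ?s = "(inv\<^bsub>bij01\<^esub> f1) t"
    have s: "?s \<in> {0..1}" "f1 ?s = t" using t range01 Bij by (auto simp only: apply_inv)
    then have "f1 ?s < f1 a2" using that order by simp
    then have "?s < a2" using homeo_plus_less_iff[OF homeo(1) s(1) points_range(1)] by simp
    then show ?thesis
      using that t s order by (simp add: base_apply[OF t] left)
  qed
  then show ?thesis
    using i assms(3) order by (auto simp: point_simps base_apply[OF t] left)
qed

lemma base_point4: "base 0 a2 = f1 a2"
  using order points_range by (simp add: base_apply left)

lemma ge_feet:
  "t \<in> {a3..1} \<Longrightarrow> b3 \<le> f2 t" "t \<in> {a4..1} \<Longrightarrow> b1 \<le> f3 t" "t \<in> {f1 a2..1} \<Longrightarrow> b2 \<le> f4 t"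
proof -
  show "b3 \<le> f2 t" if "t \<in> {a3..1}"
    using feet(2) homeo_plus_le_iff[OF homeo(2), of a3 t] points_range that by auto
  show "b1 \<le> f3 t" if "t \<in> {a4..1}"
    using feet(1) homeo_plus_le_iff[OF homeo(3), of a4 t] points_range that by auto
  show "b2 \<le> f4 t" if "t \<in> {f1 a2..1}"
    using feet(3) homeo_plus_le_iff[OF homeo(4), of "f1 a2" t] points_range that by auto
qed

text \<open>
  Beyond \<open>a3\<close> the map \<open>f2\<close> reaches \<open>b3\<close>, where \<open>f1\<close> and \<open>f3\<close> have become trivial; beyond \<open>a4\<close>
  the map \<open>f3\<close> reaches \<open>b1\<close>, where \<open>f1\<close> is trivial; and beyond \<open>f1 a2\<close> the map \<open>f4\<close> reaches
  \<open>b2\<close>, where \<open>f2\<close> and \<open>f3\<close> are trivial. So the extra factors do nothing there.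
\<close>

lemma base_right:
  assumes "i < 4" "t \<in> {point (Suc i)..1}"
  shows "base i t = base 0 t"
proof -
  have t: "t \<in> {0..1}"
    using assms points_range by (auto simp: less4 point_simps)
  have 4: "f4 t \<in> {t..1}" using t expands range01 by auto
  have 34: "f3 (f4 t) \<in> {t..1}" using 4 t expands(3)[of "f4 t"] range01[of "f4 t"] by auto
  have 234: "f2 (f3 (f4 t)) \<in> {f3 (f4 t)..1}" using 34 t expands(2)[of "f3 (f4 t)"] range01[of "f3 (f4 t)"] by auto
  have 1: "base 1 t = base 0 t" if "a3 \<le> t"
  proof -
    have "b3 \<le> f2 (f3 (f4 t))" using that 34 by (intro ge_feet) auto
    then show ?thesis using 234 order by (simp add: base_apply[OF t] right)
  qed
  have 2: "base 2 t = base 1 t" if "a4 \<le> t"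
  proof -
    have "b1 \<le> f3 (f4 t)" using that 4 by (intro ge_feet) auto
    then have "f1 (f3 (f4 t)) = f3 (f4 t)" using 34 by (simp add: right)
    then have "(inv\<^bsub>bij01\<^esub> f1) (f3 (f4 t)) = f3 (f4 t)"
      using inv_apply[OF Bij(1), of "f3 (f4 t)"] 34 t by simp
    moreover have "b3 \<le> f2 (f3 (f4 t))" using that 34 order by (intro ge_feet) auto
    ultimately show ?thesis using 234 order by (simp add: base_apply[OF t] right)
  qed
  have 3: "base 3 t = base 1 t" if "f1 a2 \<le> t"
  proof -
    have "b2 \<le> f4 t" using that t by (intro ge_feet) auto
    then show ?thesis using 4 order by (simp add: base_apply[OF t] right)
  qed
  show ?thesis
    using assms 1 2 3 order by (auto simp: less4 point_simps)
qed

lemma base_moves: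
  assumes "i < 4"
  shows "point (Suc i) < base i (point (Suc i))"
proof -
  have "base 1 a3 = f2 a3" using order points_range by (simp add: base_apply left)
  moreover have "a4 < base 2 a4"
  proof -
    let ?s = "(inv\<^bsub>bij01\<^esub> f1) (f3 a4)"
    have s: "?s \<in> {0..1}" "f1 ?s = f3 a4" using range01 Bij points_range by (auto simp only: apply_inv)
    have "?s \<le> f3 (f2 ?s)"
      using expands(2)[of ?s] expands(3)[of "f2 ?s"] range01 s by force
    then have "f1 ?s \<le> f1 (f3 (f2 ?s))"
      using homeo_plus_le_iff[OF homeo(1) s(1), of "f3 (f2 ?s)"] range01 s(1) by blast
    then show ?thesis
      using s(2) moves(3) order points_range by (simp add: base_apply left)
  qed
  moreover have "base 3 (f1 a2) = f4 (f1 a2)" using points_range by (simp add: base_apply)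
  ultimately show ?thesis
    using assms moves base_point4 by (auto simp: less4 point_simps)
qed

lemma caret_family: "caret_family bij01 (conj_extend base)"
  and separates: "separates_normal_forms bij01 (conj_extend base)"
proof -
  have "point 0 = 0" "0 \<le> point 1" "point 1 \<le> point 2" "point 2 \<le> point 3" "point 3 \<le> point 4"
    "point 4 = base 0 (point 1)" "point 4 \<le> 1"
    using order base_point4 by (simp_all add: point_simps)
  note hyps = this base_homeo base_expands base_moves base_left base_right
  show "caret_family bij01 (conj_extend base)"
    by (rule four_carets(1)[of base point]) (fact hyps)+
  show "separates_normal_forms bij01 (conj_extend base)"
    by (rule four_carets(2)[of base point]) (fact hyps)+
qed

text \<open>
  The products \<open>f1 \<otimes> f3\<close> and \<open>f2 \<otimes> f3\<close> are quotients of two of the first four maps. With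
  \<open>w = (f1 \<otimes> f3) \<otimes> (f2 \<otimes> f3) \<otimes> inv (f1 \<otimes> f3) = f1 \<otimes> f3 \<otimes> f2 \<otimes> inv f1\<close> the third map is
  \<open>w \<otimes> f3 \<otimes> f4\<close>, which yields \<open>f3\<close> and then all bumps.
\<close>

lemma generate_eq: "generate bij01 (range (conj_extend base)) = generate bij01 {f1, f2, f3, f4}"
proof (rule antisym)
  let ?F = "generate bij01 {f1, f2, f3, f4}" and ?X = "generate bij01 (range (conj_extend base))"
  have f: "f1 \<in> carrier bij01" "f2 \<in> carrier bij01" "f3 \<in> carrier bij01" "f4 \<in> carrier bij01"
    using Bij by (simp_all add: carrier_bij01)
  have F: "subgroup ?F bij01" using f by (intro bij01.generate_is_subgroup) auto
  have fF: "f1 \<in> ?F" "f2 \<in> ?F" "f3 \<in> ?F" "f4 \<in> ?F" by (auto intro: generate.incl)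
  have base: "base i \<in> ?F" if "i < 4" for i
    using that fF F by (auto simp: less4 base_simps subgroup.m_closed subgroup.m_inv_closed)
  have "conj_extend base i \<in> ?F" for i
  proof (induction i rule: induct_shift3)
    case (shift j)
    then show ?case
      using base[of 0] F by (simp add: conj_extend_shift subgroup.m_closed subgroup.m_inv_closed)
  qed (simp add: conj_extend_base base)
  then show "?X \<subseteq> ?F" by (intro bij01.generate_subgroup_incl F) auto
  have sub: "range (conj_extend base) \<subseteq> carrier bij01"
    using caret_family.closed[OF caret_family] by blast
  have X: "subgroup ?X bij01" using sub by (rule bij01.generate_is_subgroup)
  have bX: "base i \<in> ?X" if "i < 4" for i
    using generate.incl[OF rangeI, of "conj_extend base" i bij01] that
    by (simp add: conj_extend_base)
  have 4: "f4 \<in> ?X" using bX[of 3] by (simp add: base_simps)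
  have cancel: "g \<otimes>\<^bsub>bij01\<^esub> (inv\<^bsub>bij01\<^esub> g \<otimes>\<^bsub>bij01\<^esub> h) = h" "inv\<^bsub>bij01\<^esub> g \<otimes>\<^bsub>bij01\<^esub> (g \<otimes>\<^bsub>bij01\<^esub> h) = h"
    if "g \<in> carrier bij01" "h \<in> carrier bij01" for g h
    using that by (simp_all flip: bij01.m_assoc)
  have 13: "f1 \<otimes>\<^bsub>bij01\<^esub> f3 \<in> ?X"
  proof -
    have "f1 \<otimes>\<^bsub>bij01\<^esub> f3 = base 0 \<otimes>\<^bsub>bij01\<^esub> inv\<^bsub>bij01\<^esub> base (Suc 0)"
      using f by (simp add: base_simps bij01.m_assoc bij01.inv_mult_group cancel)
    then show ?thesis using bX X by (simp add: subgroup.m_closed subgroup.m_inv_closed)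
  qed
  have 23: "f2 \<otimes>\<^bsub>bij01\<^esub> f3 \<in> ?X"
  proof -
    have "f2 \<otimes>\<^bsub>bij01\<^esub> f3 = base (Suc 0) \<otimes>\<^bsub>bij01\<^esub> inv\<^bsub>bij01\<^esub> f4"
      using f by (simp add: base_simps bij01.m_assoc bij01.inv_mult_group cancel)
    then show ?thesis using bX X 4 by (simp add: subgroup.m_closed subgroup.m_inv_closed)
  qed
  let ?w = "f1 \<otimes>\<^bsub>bij01\<^esub> f3 \<otimes>\<^bsub>bij01\<^esub> (f2 \<otimes>\<^bsub>bij01\<^esub> f3) \<otimes>\<^bsub>bij01\<^esub> inv\<^bsub>bij01\<^esub> (f1 \<otimes>\<^bsub>bij01\<^esub> f3)"
  have 3: "f3 \<in> ?X"
  proof -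
    have "f3 = inv\<^bsub>bij01\<^esub> ?w \<otimes>\<^bsub>bij01\<^esub> base 2 \<otimes>\<^bsub>bij01\<^esub> inv\<^bsub>bij01\<^esub> f4"
      using f by (simp add: base_simps bij01.m_assoc bij01.inv_mult_group cancel)
    moreover have "?w \<in> ?X" using 13 23 X by (simp add: subgroup.m_closed subgroup.m_inv_closed)
    ultimately show ?thesis
      using bX[of 2] 4 X by (metis less4 subgroup.m_closed subgroup.m_inv_closed)
  qed
  have "f1 = f1 \<otimes>\<^bsub>bij01\<^esub> f3 \<otimes>\<^bsub>bij01\<^esub> inv\<^bsub>bij01\<^esub> f3" "f2 = f2 \<otimes>\<^bsub>bij01\<^esub> f3 \<otimes>\<^bsub>bij01\<^esub> inv\<^bsub>bij01\<^esub> f3"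
    using f by (simp_all add: bij01.m_assoc)
  then have "f1 \<in> ?X" "f2 \<in> ?X"
    using 3 13 23 X by (metis subgroup.m_closed subgroup.m_inv_closed)+
  then show "?F \<subseteq> ?X" using 3 4 by (intro bij01.generate_subgroup_incl X) auto
qed

end

lemma fast_bumps_of_feet:
  fixes f :: "nat \<Rightarrow> real \<Rightarrow> real" and L R :: "nat \<Rightarrow> real set"
  assumes bump: "\<And>i. i \<in> {1..4} \<Longrightarrow> positive_bump (f i)"
    and feet: "\<And>i. i \<in> {1..4} \<Longrightarrow> pair_of_feet (f i) (L i) (R i)"
    and ord: "sorted_wrt left_of [L 1, L 2, L 3, L 4, R 1, R 3, R 2, R 4]"
  shows "\<exists>a2 a3 a4 b1 b2 b3. fast_bumps (f 1) (f 2) (f 3) (f 4) a2 a3 a4 b1 b2 b3"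
proof -
  have "\<forall>i\<in>{1..4}. \<exists>a b c. orbital (f i) {a<..<b} \<and> c \<in> {a<..<b} \<and> L i = {a<..<c} \<and> R i = {f i c<..<b}"
    using feet unfolding pair_of_feet_def by blast
  then obtain a b c where abc:
    "\<And>i. i \<in> {1..4} \<Longrightarrow> orbital (f i) {a i<..<b i} \<and> c i \<in> {a i<..<b i} \<and>
       L i = {a i<..<c i} \<and> R i = {f i (c i)<..<b i}"
    by metis
  have LR: "L i = {a i<..<c i}" "R i = {f i (c i)<..<b i}" "a i < c i" "c i < b i" if "i \<in> {1..4}" for i
    using abc[OF that] by auto
  have ab: "a i < b i" if "i \<in> {1..4}" for i using LR(3,4)[OF that] by simp
  note props = positive_bump_orbital[OF bump _ ab]
  have orb: "orbital (f i) {a i<..<b i}" if "i \<in> {1..4}" for i using abc[OF that] by simp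
  have homeo: "f i \<in> homeo_plus" "0 \<le> a i" "b i \<le> 1" if "i \<in> {1..4}" for i
    using props(1-3)[OF that orb[OF that] that] by auto
  have exp: "t \<le> f i t" if "i \<in> {1..4}" "t \<in> {0..1}" for i t
    using props(4)[OF that(1) orb[OF that(1)] that] .
  have mv: "t < f i t" if "i \<in> {1..4}" "a i < t" "t < b i" for i t
    using props(5)[OF that(1) orb[OF that(1)] that] .
  have fx: "f i t = t" if "i \<in> {1..4}" "t \<in> {0..1}" "t \<le> a i \<or> b i \<le> t" for i t
    using props(6)[OF that(1) orb[OF that(1)] that] .
  have lt: "f i s < f i t \<longleftrightarrow> s < t" "f i s \<le> f i t \<longleftrightarrow> s \<le> t" if "i \<in> {1..4}" "s \<in> {0..1}" "t \<in> {0..1}" for i s t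
    using homeo_plus_less_iff[OF homeo(1)] homeo_plus_le_iff[OF homeo(1)] that by blast+
  have fcb: "f i (c i) < b i" if "i \<in> {1..4}" for i
  proof -
    have "f i (c i) < f i (b i)" using LR[OF that] homeo(2,3)[OF that] lt[OF that] by simp
    also have "\<dots> = b i" using fx[OF that] LR[OF that] homeo(2,3)[OF that] by simp
    finally show ?thesis .
  qed
  have i: "1 \<in> {1..4::nat}" "2 \<in> {1..4::nat}" "3 \<in> {1..4::nat}" "4 \<in> {1..4::nat}" by auto
  have ord': "left_of (L 1) (L 2)" "left_of (L 2) (L 3)" "left_of (L 3) (L 4)"
    "left_of (L 4) (R 1)" "left_of (R 1) (R 3)" "left_of (R 3) (R 2)" "left_of (R 2) (R 4)"
    using ord by simp_all
  have o: "c 1 \<le> a 2" "c 2 \<le> a 3" "c 3 \<le> a 4" "c 4 \<le> f 1 (c 1)" "b 1 \<le> f 3 (c 3)"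
    "b 3 \<le> f 2 (c 2)" "b 2 \<le> f 4 (c 4)"
    using ord' unfolding LR(1,2)[OF i(1)] LR(1,2)[OF i(2)] LR(1,2)[OF i(3)] LR(1,2)[OF i(4)]
    by (meson foot_left_of LR(3)[OF i(1)] LR(3)[OF i(2)] LR(3)[OF i(3)] LR(3)[OF i(4)] fcb i)+
  note chain = o LR(3,4)[OF i(1)] LR(3,4)[OF i(2)] LR(3,4)[OF i(3)] LR(3,4)[OF i(4)]
    fcb[OF i(1)] fcb[OF i(2)] fcb[OF i(3)] fcb[OF i(4)] homeo(2)[OF i(1)] homeo(3)[OF i(4)]
  have "f 1 (c 1) \<le> f 1 (a 2)" "f 1 (a 2) < f 1 (b 1)"
    using lt[OF i(1)] chain by simp_all
  moreover have "f 1 (b 1) = b 1" using fx[OF i(1)] chain by simp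
  ultimately have p4: "f 1 (c 1) \<le> f 1 (a 2)" "f 1 (a 2) < b 1" by simp_all
  have ft: "f 3 (c 3) \<le> f 3 (a 4)" "f 2 (c 2) \<le> f 2 (a 3)" "f 4 (c 4) \<le> f 4 (f 1 (a 2))"
    using lt[OF i(3)] lt[OF i(2)] lt[OF i(4)] chain p4 by simp_all
  have m: "a 2 < f 1 (a 2)" "a 3 < f 2 (a 3)" "a 4 < f 3 (a 4)" "f 1 (a 2) < f 4 (f 1 (a 2))"
    using chain p4 by (auto intro!: mv)
  have "fast_bumps (f 1) (f 2) (f 3) (f 4) (a 2) (a 3) (a 4) (b 1) (b 2) (b 3)"
  proof unfold_locales
    fix t :: real
    show "f 2 t = t" if "t \<in> {0..a 2}" using that chain by (intro fx) auto
    show "f 3 t = t" if "t \<in> {0..a 3}" using that chain by (intro fx) auto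
    show "f 4 t = t" if "t \<in> {0..a 4}" using that chain by (intro fx) auto
    show "f 1 t = t" if "t \<in> {b 1..1}" using that chain by (intro fx) auto
    show "f 2 t = t" if "t \<in> {b 2..1}" using that chain by (intro fx) auto
    show "f 3 t = t" if "t \<in> {b 3..1}" using that chain by (intro fx) auto
  qed ((rule homeo(1) exp; (rule i | assumption)) | (use chain p4 ft m in linarith))+
  then show ?thesis by blast
qed

section \<open>The Thompson group as a subgroup\<close>

lemma Z_quarter_iff: "x \<in> Z_quarter \<longleftrightarrow> (\<exists>m. x * 4 ^ m \<in> \<int>)"
proof
  assume "x \<in> Z_quarter"
  then obtain i :: int and m where "x = of_int i / 4 ^ m" by (auto simp: Z_quarter_def)
  then have "x * 4 ^ m = of_int i" by simp
  then show "\<exists>m. x * 4 ^ m \<in> \<int>" by (metis Ints_of_int)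
next
  assume "\<exists>m. x * 4 ^ m \<in> \<int>"
  then obtain m i where "x * 4 ^ m = of_int i" by (auto elim: Ints_cases)
  then have "x = of_int i / 4 ^ m" by (simp add: field_simps)
  then show "x \<in> Z_quarter" unfolding Z_quarter_def by blast
qed

lemma Ints_refine:
  fixes x :: real
  assumes "x * 4 ^ m \<in> \<int>" "m \<le> n"
  shows "x * 4 ^ n \<in> \<int>"
proof -
  have "x * 4 ^ n = (x * 4 ^ m) * 4 ^ (n - m)"
    using assms(2) by (simp flip: power_add)
  also have "\<dots> \<in> \<int>" by (rule Ints_mult[OF assms(1)]) simp
  finally show ?thesis .
qed

lemma Z_quarter_add:
  assumes "x \<in> Z_quarter" "y \<in> Z_quarter"
  shows "x + y \<in> Z_quarter"
proof -
  obtain m n where "x * 4 ^ m \<in> \<int>" "y * 4 ^ n \<in> \<int>" using assms by (auto simp: Z_quarter_iff)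
  then have "x * 4 ^ max m n \<in> \<int>" "y * 4 ^ max m n \<in> \<int>" by (auto intro: Ints_refine)
  then have "(x + y) * 4 ^ max m n \<in> \<int>" by (simp add: distrib_right)
  then show ?thesis by (auto simp: Z_quarter_iff)
qed

lemma Z_quarter_minus: "x \<in> Z_quarter \<Longrightarrow> - x \<in> Z_quarter"
  by (auto simp: Z_quarter_iff)

lemma Z_quarter_diff: "x \<in> Z_quarter \<Longrightarrow> y \<in> Z_quarter \<Longrightarrow> x - y \<in> Z_quarter"
  using Z_quarter_add[of x "- y"] by (simp add: Z_quarter_minus)

lemma Z_quarter_powi:
  assumes "x \<in> Z_quarter"
  shows "4 powi k * x \<in> Z_quarter"
proof -
  obtain m where m: "x * 4 ^ m \<in> \<int>" using assms by (auto simp: Z_quarter_iff)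
  show ?thesis
  proof (cases "0 \<le> k")
    case True
    have "4 powi k * x * 4 ^ m = (x * 4 ^ m) * 4 ^ nat k" using True by (simp add: power_int_def)
    also have "\<dots> \<in> \<int>" by (rule Ints_mult[OF m]) simp
    finally show ?thesis by (auto simp: Z_quarter_iff)
  next
    case False
    have "4 powi k * x * 4 ^ (m + nat (- k)) = x * 4 ^ m"
      using False by (simp add: power_int_def power_add field_simps)
    then show ?thesis using m unfolding Z_quarter_iff by metis
  qed
qed

lemma Z_quarter_powi_iff: "4 powi k * x \<in> Z_quarter \<longleftrightarrow> x \<in> Z_quarter"
proof
  assume "4 powi k * x \<in> Z_quarter"
  then have "4 powi (- k) * (4 powi k * x) \<in> Z_quarter" by (rule Z_quarter_powi)
  also have "4 powi (- k) * (4 powi k * x) = x"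
    by (simp add: power_int_minus)
  finally show "x \<in> Z_quarter" .
qed (rule Z_quarter_powi)

lemma Z_quarter_dyadic: "real j / 4 ^ m \<in> Z_quarter"
  unfolding Z_quarter_iff by (rule exI[of _ m]) simp

lemma thompsonE:
  assumes "g \<in> thompson_F4_set"
  obtains B where "finite B" "B \<subseteq> Z_quarter"
    and "\<And>a b. 0 \<le> a \<Longrightarrow> a < b \<Longrightarrow> b \<le> 1 \<Longrightarrow> {a<..<b} \<inter> B = {} \<Longrightarrow>
      \<exists>(k::int) c. \<forall>x\<in>{a..b}. g x = 4 powi k * x + c"
proof -
  from assms show thesis
    unfolding thompson_F4_set_def mem_Collect_eq
    by (elim conjE exE) (rule that, assumption+, simp)
qed

lemma thompsonI:
  assumes "g \<in> homeo_plus" "finite B" "B \<subseteq> Z_quarter"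
    and "\<And>a b. 0 \<le> a \<Longrightarrow> a < b \<Longrightarrow> b \<le> 1 \<Longrightarrow> {a<..<b} \<inter> B = {} \<Longrightarrow>
      \<exists>(k::int) c. \<forall>x\<in>{a..b}. g x = 4 powi k * x + c"
  shows "g \<in> thompson_F4_set"
  unfolding thompson_F4_set_def
  by (intro CollectI conjI exI[of _ B] allI impI assms) simp_all

text \<open>
  As soon as all breakpoints are multiples of \<open>1 / 4 ^ n\<close>, there is none inside an interval of the
  uniform subdivision into \<open>4 ^ n\<close> parts.
\<close>

lemma thompson_mesh:
  assumes "g \<in> thompson_F4_set"
  shows "\<exists>m. \<forall>n\<ge>m. \<forall>j<4 ^ n. \<exists>(k::int) c. \<forall>x\<in>{real j / 4 ^ n..(real j + 1) / 4 ^ n}. g x = 4 powi k * x + c"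
proof -
  obtain B where B: "finite B" "B \<subseteq> Z_quarter"
    and affine: "\<And>a b. 0 \<le> a \<Longrightarrow> a < b \<Longrightarrow> b \<le> 1 \<Longrightarrow> {a<..<b} \<inter> B = {} \<Longrightarrow>
      \<exists>(k::int) c. \<forall>x\<in>{a..b}. g x = 4 powi k * x + c"
    by (rule thompsonE[OF assms]) (rule that; blast)
  obtain e where e: "\<And>b. b \<in> B \<Longrightarrow> b * 4 ^ e b \<in> \<int>"
    using B(2) unfolding Z_quarter_iff subset_iff by metis
  define m where "m = Max (insert 0 (e ` B))"
  have m: "b * 4 ^ n \<in> \<int>" if "b \<in> B" "m \<le> n" for b n
  proof -
    have "e b \<le> m" unfolding m_def using that(1) B(1) by (intro Max_ge) auto
    then show ?thesis using that(2) by (intro Ints_refine[OF e[OF that(1)]]) linarith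
  qed
  show ?thesis
  proof (intro exI[of _ m] allI impI)
    fix n j :: nat assume n: "m \<le> n" and j: "j < 4 ^ n"
    have "{real j / 4 ^ n<..<(real j + 1) / 4 ^ n} \<inter> B = {}"
    proof (rule ccontr)
      assume "\<not> ?thesis"
      then obtain b where b: "b \<in> B" "real j / 4 ^ n < b" "b < (real j + 1) / 4 ^ n" by auto
      then obtain i :: int where "b * 4 ^ n = of_int i" using m n by (metis Ints_cases)
      then have "of_int (int j) < (of_int i :: real)" "of_int i < (of_int (int j + 1) :: real)"
        using b by (simp_all add: field_simps)
      then show False unfolding of_int_less_iff by linarith
    qed
    moreover have "real j + 1 \<le> 4 ^ n"
      using j by (metis Suc_leI of_nat_Suc of_nat_le_iff of_nat_numeral of_nat_power add.commute)
    ultimately show "\<exists>(k::int) c. \<forall>x\<in>{real j / 4 ^ n..(real j + 1) / 4 ^ n}. g x = 4 powi k * x + c"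
      by (intro affine) (auto simp: divide_strict_right_mono)
  qed
qed

lemma thompson_homeo: "g \<in> thompson_F4_set \<Longrightarrow> g \<in> homeo_plus"
  by (simp add: thompson_F4_set_def)

text \<open>
  Walking along a uniform subdivision from the fixed point 0 shows that the translation parts lie in
  \<open>Z_quarter\<close>. This keeps the breakpoints of products and inverses in \<open>Z_quarter\<close>.
\<close>

lemma thompson_Z_quarter_iff:
  assumes g: "g \<in> thompson_F4_set" and x: "x \<in> {0..1}"
  shows "g x \<in> Z_quarter \<longleftrightarrow> x \<in> Z_quarter"
proof -
  obtain n where n: "\<And>j. j < 4 ^ n \<Longrightarrow> \<exists>(k::int) c. \<forall>x\<in>{real j / 4 ^ n..(real j + 1) / 4 ^ n}. g x = 4 powi k * x + c"
    using thompson_mesh[OF g] by blast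
  have iff: "g y \<in> Z_quarter \<longleftrightarrow> y \<in> Z_quarter"
    if j: "j < 4 ^ n" "g (real j / 4 ^ n) \<in> Z_quarter" and y: "y \<in> {real j / 4 ^ n..(real j + 1) / 4 ^ n}" for j y
  proof -
    obtain k :: int and c where kc: "\<And>x. x \<in> {real j / 4 ^ n..(real j + 1) / 4 ^ n} \<Longrightarrow> g x = 4 powi k * x + c"
      using n[OF j(1)] by blast
    have "c = g (real j / 4 ^ n) - 4 powi k * (real j / 4 ^ n)"
      using kc[of "real j / 4 ^ n"] by (simp add: divide_right_mono)
    then have c: "c \<in> Z_quarter"
      using j(2) by (simp add: Z_quarter_diff Z_quarter_powi Z_quarter_dyadic del: times_divide_eq_right)
    have "g y \<in> Z_quarter \<longleftrightarrow> 4 powi k * y \<in> Z_quarter"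
      using kc[OF y] c Z_quarter_add[OF _ c] Z_quarter_diff[OF _ c] by (metis add_diff_cancel_right')
    then show ?thesis by (simp add: Z_quarter_powi_iff)
  qed
  have mesh: "g (real j / 4 ^ n) \<in> Z_quarter" if "j \<le> 4 ^ n" for j
    using that
  proof (induction j)
    case 0
    then show ?case
      using homeo_plus_endpoints(1)[OF thompson_homeo[OF g]] Z_quarter_dyadic[of 0 0] by simp
  next
    case (Suc j)
    then show ?case
      using iff[of j "real (Suc j) / 4 ^ n"] Z_quarter_dyadic[of "Suc j" n]
      by (auto simp: divide_right_mono)
  qed
  show ?thesis
  proof (cases "x = 1")
    case True
    then show ?thesis
      using homeo_plus_endpoints(2)[OF thompson_homeo[OF g]] by simp
  next
    case False
    define j where "j = nat \<lfloor>x * 4 ^ n\<rfloor>"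
    have j: "real j \<le> x * 4 ^ n" "x * 4 ^ n < real j + 1"
      using x by (simp_all add: j_def)
    moreover have "x * 4 ^ n < 4 ^ n" using False x by simp
    ultimately have "real j < 4 ^ n" by linarith
    then have "j < 4 ^ n" by (metis of_nat_less_iff of_nat_numeral of_nat_power)
    then show ?thesis using iff[of j x] mesh[of j] j by (simp add: field_simps)
  qed
qed

lemma thompson_mult:
  assumes g: "g \<in> thompson_F4_set" and h: "h \<in> thompson_F4_set"
  shows "g \<otimes>\<^bsub>bij01\<^esub> h \<in> thompson_F4_set"
proof -
  have gh: "g \<in> homeo_plus" "h \<in> homeo_plus" using g h by (simp_all add: thompson_homeo)
  note Bij = gh[THEN homeo_plus_Bij]
  obtain B where B: "finite B" "B \<subseteq> Z_quarter"
    and g_affine: "\<And>a b. 0 \<le> a \<Longrightarrow> a < b \<Longrightarrow> b \<le> 1 \<Longrightarrow> {a<..<b} \<inter> B = {} \<Longrightarrow>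
      \<exists>(k::int) c. \<forall>x\<in>{a..b}. g x = 4 powi k * x + c"
    by (rule thompsonE[OF g]) (rule that; blast)
  obtain C where C: "finite C" "C \<subseteq> Z_quarter"
    and h_affine: "\<And>a b. 0 \<le> a \<Longrightarrow> a < b \<Longrightarrow> b \<le> 1 \<Longrightarrow> {a<..<b} \<inter> C = {} \<Longrightarrow>
      \<exists>(k::int) c. \<forall>x\<in>{a..b}. h x = 4 powi k * x + c"
    by (rule thompsonE[OF h]) (rule that; blast)
  let ?D = "C \<union> (inv\<^bsub>bij01\<^esub> h) ` (B \<inter> {0..1})"
  have "\<exists>(k::int) c. \<forall>x\<in>{a..b}. (g \<otimes>\<^bsub>bij01\<^esub> h) x = 4 powi k * x + c"
    if ab: "0 \<le> a" "a < b" "b \<le> 1" and disj: "{a<..<b} \<inter> ?D = {}" for a b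
  proof -
    have 01: "a \<in> {0..1}" "b \<in> {0..1}" using ab by auto
    have "{h a<..<h b} \<inter> B = {}"
    proof (rule ccontr)
      assume "\<not> ?thesis"
      then obtain y where y: "y \<in> B" "h a < y" "y < h b" by auto
      then have y01: "y \<in> {0..1}" using Bij01_range[OF Bij(2) 01(1)] Bij01_range[OF Bij(2) 01(2)] by auto
      let ?x = "(inv\<^bsub>bij01\<^esub> h) y"
      have "?x \<in> {0..1}" "h ?x = y"
        using y01 Bij by (auto simp only: apply_inv intro: Bij01_range inv_Bij)
      then have "?x \<in> {a<..<b}"
        using y homeo_plus_less_iff[OF gh(2) 01(1), of ?x] homeo_plus_less_iff[OF gh(2) _ 01(2), of ?x] by simp
      then show False using disj y y01 by blast
    qed
    moreover have "h a < h b" using gh(2) 01 ab by (simp add: homeo_plus_less_iff)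
    ultimately obtain k c where kc: "\<And>x. x \<in> {h a..h b} \<Longrightarrow> g x = 4 powi (k::int) * x + c"
      using g_affine[of "h a" "h b"] Bij01_range[OF Bij(2) 01(1)] Bij01_range[OF Bij(2) 01(2)] by auto
    obtain l d where ld: "\<And>x. x \<in> {a..b} \<Longrightarrow> h x = 4 powi (l::int) * x + d"
      using h_affine[of a b] ab disj by blast
    have "(g \<otimes>\<^bsub>bij01\<^esub> h) x = 4 powi (k + l) * x + (4 powi k * d + c)" if x: "x \<in> {a..b}" for x
    proof -
      have x01: "x \<in> {0..1}" using x ab by auto
      have "h x \<in> {h a..h b}" using x x01 01 gh(2) by (simp add: homeo_plus_le_iff)
      then have "g (h x) = 4 powi k * (4 powi l * x + d) + c" using kc ld x by simp
      then show ?thesis using x01 Bij by (simp add: mult_apply power_int_add algebra_simps)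
    qed
    then show ?thesis by blast
  qed
  moreover have "?D \<subseteq> Z_quarter"
  proof -
    have "(inv\<^bsub>bij01\<^esub> h) y \<in> Z_quarter" if "y \<in> B" "y \<in> {0..1}" for y
      using that B(2) thompson_Z_quarter_iff[OF h, of "(inv\<^bsub>bij01\<^esub> h) y"] Bij
        Bij01_range[OF inv_Bij[OF Bij(2)] that(2)] by (auto simp only: apply_inv)
    then show ?thesis using C(2) by auto
  qed
  moreover have "finite ?D" using B(1) C(1) by simp
  ultimately show ?thesis
    by (intro thompsonI[of _ ?D] homeo_plus_mult gh)
qed

lemma thompson_inv:
  assumes g: "g \<in> thompson_F4_set"
  shows "inv\<^bsub>bij01\<^esub> g \<in> thompson_F4_set"
proof -
  have homeo: "g \<in> homeo_plus" using g by (simp add: thompson_homeo)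
  then have Bij: "g \<in> Bij {0..1}" by (rule homeo_plus_Bij)
  let ?h = "inv\<^bsub>bij01\<^esub> g"
  have h: "?h y \<in> {0..1}" "g (?h y) = y" if "y \<in> {0..1}" for y
    using that Bij by (auto simp only: apply_inv intro: Bij01_range inv_Bij)
  have h_homeo: "?h \<in> homeo_plus" using homeo by (rule homeo_plus_inv)
  obtain B where B: "finite B" "B \<subseteq> Z_quarter"
    and affine: "\<And>a b. 0 \<le> a \<Longrightarrow> a < b \<Longrightarrow> b \<le> 1 \<Longrightarrow> {a<..<b} \<inter> B = {} \<Longrightarrow>
      \<exists>(k::int) c. \<forall>x\<in>{a..b}. g x = 4 powi k * x + c"
    by (rule thompsonE[OF g]) (rule that; blast)
  let ?D = "g ` (B \<inter> {0..1})"
  have "\<exists>(k::int) c. \<forall>y\<in>{a..b}. ?h y = 4 powi k * y + c"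
    if ab: "0 \<le> a" "a < b" "b \<le> 1" and disj: "{a<..<b} \<inter> ?D = {}" for a b
  proof -
    have 01: "a \<in> {0..1}" "b \<in> {0..1}" using ab by auto
    have "{?h a<..<?h b} \<inter> B = {}"
    proof (rule ccontr)
      assume "\<not> ?thesis"
      then obtain x where x: "x \<in> B" "?h a < x" "x < ?h b" by auto
      then have x01: "x \<in> {0..1}" using h(1)[OF 01(1)] h(1)[OF 01(2)] by auto
      then have "g x \<in> {a<..<b}"
        using x h[OF 01(1)] h[OF 01(2)] homeo_plus_less_iff[OF homeo _ x01, of "?h a"]
          homeo_plus_less_iff[OF homeo x01, of "?h b"] by simp
      then show False using disj x x01 by blast
    qed
    moreover have "?h a < ?h b" using h_homeo 01 ab by (simp add: homeo_plus_less_iff)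
    ultimately obtain k c where kc: "\<And>x. x \<in> {?h a..?h b} \<Longrightarrow> g x = 4 powi (k::int) * x + c"
      using affine[of "?h a" "?h b"] h(1)[OF 01(1)] h(1)[OF 01(2)] by auto
    have "?h y = 4 powi (- k) * y + (- (4 powi (- k) * c))" if y: "y \<in> {a..b}" for y
    proof -
      have y01: "y \<in> {0..1}" using y ab by auto
      have "?h y \<in> {?h a..?h b}" using y y01 01 h_homeo by (simp add: homeo_plus_le_iff)
      then have "y = 4 powi k * ?h y + c" using kc h(2)[OF y01] by metis
      then have "4 powi (- k) * y = 4 powi (- k) * (4 powi k * ?h y + c)" by simp
      also have "\<dots> = ?h y + 4 powi (- k) * c" by (simp add: power_int_minus distrib_left)
      finally show ?thesis by simp
    qed
    then show ?thesis by blast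
  qed
  moreover have "?D \<subseteq> Z_quarter"
    using B(2) thompson_Z_quarter_iff[OF g] by blast
  moreover have "finite ?D" using B(1) by simp
  ultimately show ?thesis
    by (intro thompsonI[of _ ?D] h_homeo)
qed

lemma subgroup_thompson: "subgroup thompson_F4_set bij01"
proof (rule subgroup.intro)
  show "thompson_F4_set \<subseteq> carrier bij01"
    using thompson_homeo homeo_plus_Bij by (auto simp: carrier_bij01)
  show "\<one>\<^bsub>bij01\<^esub> \<in> thompson_F4_set"
  proof -
    have "\<one>\<^bsub>bij01\<^esub> \<in> homeo_plus"
      using bij01.one_closed by (auto simp: homeo_plus_iff carrier_bij01 strict_mono_on_def one_apply)
    moreover have "\<forall>x\<in>{a..b}. \<one>\<^bsub>bij01\<^esub> x = 4 powi 0 * x + 0" if "0 \<le> a" "b \<le> 1" for a b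
      using that by (simp add: one_apply)
    ultimately show ?thesis by (intro thompsonI[of _ "{}"]) blast+
  qed
qed (simp_all add: thompson_mult thompson_inv)

section \<open>The half-line model\<close>

text \<open>
  A chart of \<open>{0..<1}\<close> by the half-line that turns unit intervals into standard 4-adic intervals. Each
  block of three units covers the left three quarters of what remains of the unit interval:
  \<open>[3q, 3q + 3]\<close> is mapped onto \<open>[1 - 1/4^q, 1 - 1/4^(q+1)]\<close>. Near 1 a slope of \<open>1/4^n\<close> becomes the
  translation by \<open>3n\<close>.
\<close>

definition psi :: "real \<Rightarrow> real" where
  "psi t = (let q = nat \<lfloor>t / 3\<rfloor> in 1 - (1 - (t - 3 * real q) / 4) / 4 ^ q)"

lemma psi_eq:
  fixes q :: nat
  assumes "3 * real q \<le> t" "t \<le> 3 * real q + 3"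
  shows "psi t = 1 - (1 - (t - 3 * real q) / 4) / 4 ^ q"
proof (cases "t = 3 * real q + 3")
  case True
  then have "\<lfloor>t / 3\<rfloor> = int (q + 1)" by (simp add: add_divide_distrib)
  then have "nat \<lfloor>t / 3\<rfloor> = q + 1" by simp
  then show ?thesis by (simp add: psi_def True field_simps)
next
  case False
  then have "\<lfloor>t / 3\<rfloor> = int q" using assms by (intro floor_unique) auto
  then have "nat \<lfloor>t / 3\<rfloor> = q" by simp
  then show ?thesis by (simp add: psi_def)
qed

lemma third_floor:
  assumes "0 \<le> t"
  obtains q :: nat where "3 * real q \<le> t" "t < 3 * real q + 3"
proof
  show "3 * real (nat \<lfloor>t / 3\<rfloor>) \<le> t" "t < 3 * real (nat \<lfloor>t / 3\<rfloor>) + 3"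
    using assms by linarith+
qed

lemma psi_shift:
  fixes n :: nat
  assumes "0 \<le> t"
  shows "psi (t + 3 * real n) = 1 - (1 - psi t) / 4 ^ n"
proof -
  obtain q :: nat where q: "3 * real q \<le> t" "t < 3 * real q + 3" using third_floor[OF assms] .
  have "psi (t + 3 * real n) = 1 - (1 - (t + 3 * real n - 3 * real (q + n)) / 4) / 4 ^ (q + n)"
    using q by (intro psi_eq) auto
  also have "\<dots> = 1 - (1 - psi t) / 4 ^ n"
    using q by (simp add: psi_eq[of q t] power_add)
  finally show ?thesis .
qed

lemma psi_0 [simp]: "psi 0 = 0"
  by (simp add: psi_def)

lemma psi_triple: "psi (3 * real n) = 1 - 1 / 4 ^ n"
  using psi_shift[of 0 n] by simp

lemma psi_unit:
  fixes n :: nat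
  assumes "0 \<le> s" "s \<le> 1"
  shows "psi (real n + s) = psi (real n) + s / 4 ^ (n div 3 + 1)"
proof -
  let ?q = "n div 3"
  have q: "3 * ?q \<le> n" "n + 1 \<le> 3 * ?q + 3" by linarith+
  then have "3 * real ?q \<le> real n" "real n + 1 \<le> 3 * real ?q + 3" by linarith+
  then have "psi (real n + s) = 1 - (1 - (real n + s - 3 * real ?q) / 4) / 4 ^ ?q"
    "psi (real n) = 1 - (1 - (real n - 3 * real ?q) / 4) / 4 ^ ?q"
    using assms by (auto intro!: psi_eq)
  then show ?thesis by (simp add: field_simps)
qed

lemma psi_bounds:
  fixes q :: nat
  assumes "3 * real q \<le> t" "t < 3 * real q + 3"
  shows "1 - 1 / 4 ^ q \<le> psi t" "psi t < 1 - 1 / 4 ^ Suc q"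
proof -
  have "psi t = 1 - (1 - (t - 3 * real q) / 4) / 4 ^ q" using assms by (intro psi_eq) auto
  moreover have "(1 - (t - 3 * real q) / 4) / 4 ^ q \<le> 1 / 4 ^ q"
    using assms by (intro divide_right_mono) auto
  moreover have "(1 / 4) / 4 ^ q < (1 - (t - 3 * real q) / 4) / 4 ^ q"
    using assms by (intro divide_strict_right_mono) auto
  ultimately show "1 - 1 / 4 ^ q \<le> psi t" "psi t < 1 - 1 / 4 ^ Suc q" by simp_all
qed

lemma psi_less: 
  assumes "0 \<le> s" "s < t"
  shows "psi s < psi t"
proof -
  obtain p :: nat where p: "3 * real p \<le> s" "s < 3 * real p + 3" using third_floor[OF assms(1)] .
  obtain q :: nat where q: "3 * real q \<le> t" "t < 3 * real q + 3" using third_floor[of t] assms by auto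
  have "3 * real p < 3 * real q + 3" using p q assms by linarith
  then have "p \<le> q" by linarith
  show ?thesis
  proof (cases "p = q")
    case True
    then show ?thesis using p q assms by (simp add: psi_eq[of q] divide_strict_right_mono)
  next
    case False
    then have "(4::real) ^ Suc p \<le> 4 ^ q" using \<open>p \<le> q\<close> by (intro power_increasing) auto
    then have "1 / 4 ^ q \<le> 1 / (4::real) ^ Suc p" by (intro divide_left_mono) auto
    then show ?thesis using psi_bounds[OF p] psi_bounds[OF q] by linarith
  qed
qed

lemma psi_less_iff: "0 \<le> s \<Longrightarrow> 0 \<le> t \<Longrightarrow> psi s < psi t \<longleftrightarrow> s < t"
  using psi_less[of s t] psi_less[of t s] by (cases s t rule: linorder_cases) auto

lemma psi_le_iff: "0 \<le> s \<Longrightarrow> 0 \<le> t \<Longrightarrow> psi s \<le> psi t \<longleftrightarrow> s \<le> t"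
  using psi_less_iff[of t s] by (simp add: not_less[symmetric])

lemma psi_eq_iff: "0 \<le> s \<Longrightarrow> 0 \<le> t \<Longrightarrow> psi s = psi t \<longleftrightarrow> s = t"
  using psi_le_iff[of s t] psi_le_iff[of t s] by (simp add: eq_iff)

lemma psi_range:
  assumes "0 \<le> t"
  shows "0 \<le> psi t" "psi t < 1"
proof -
  show "0 \<le> psi t" using psi_le_iff[of 0 t] assms by simp
  obtain q :: nat where q: "3 * real q \<le> t" "t < 3 * real q + 3" using third_floor[OF assms] .
  have "0 < 1 / (4::real) ^ Suc q" by simp
  then show "psi t < 1" using psi_bounds(2)[OF q] by linarith
qed

lemma psi_surj:
  assumes "0 \<le> y" "y < 1"
  obtains t where "0 \<le> t" "psi t = y"
proof -
  obtain n where "(1 / 4 :: real) ^ n < 1 - y" using assms real_arch_pow_inv[of "1 - y" "1 / 4"] by auto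
  then have n: "y < 1 - 1 / 4 ^ n" by (simp add: power_divide)
  define q where "q = (LEAST q. y < 1 - 1 / (4::real) ^ Suc q)"
  have "\<exists>q. y < 1 - 1 / (4::real) ^ Suc q"
  proof
    have "1 / 4 ^ Suc n \<le> 1 / (4::real) ^ n" by (simp add: field_simps)
    then show "y < 1 - 1 / 4 ^ Suc n" using n by linarith
  qed
  then have q: "y < 1 - 1 / 4 ^ Suc q" unfolding q_def by (rule LeastI_ex)
  have q': "1 - 1 / 4 ^ q \<le> y"
  proof (cases q)
    case (Suc r)
    then have "\<not> y < 1 - 1 / 4 ^ Suc r" using not_less_Least[of r "\<lambda>q. y < 1 - 1 / 4 ^ Suc q"] unfolding q_def by simp
    then show ?thesis using Suc by simp
  qed (use assms in simp)
  define w where "w = 1 - 4 ^ q * (1 - y)"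
  have w: "0 \<le> w" "4 * w \<le> 3"
    using q q' by (simp_all add: w_def field_simps)
  then have "psi (3 * real q + 4 * w) = 1 - (1 - w) / 4 ^ q"
    by (subst psi_eq[of q]) auto
  also have "\<dots> = y" by (simp add: w_def)
  finally have "psi (3 * real q + 4 * w) = y" .
  moreover have "0 \<le> 3 * real q + 4 * w" using w by simp
  ultimately show thesis using that by blast
qed

text \<open>
  Conjugation by the chart, with the value at 1 filled in.
\<close>

definition transport :: "(real \<Rightarrow> real) \<Rightarrow> real \<Rightarrow> real" where
  "transport h = (\<lambda>y\<in>{0..1}. if y = 1 then 1 else psi (h (the_inv_into {0..} psi y)))"

lemma transport_psi:
  assumes "0 \<le> t"
  shows "transport h (psi t) = psi (h t)"
proof -
  have "inj_on psi {0..}" by (intro inj_onI) (simp add: psi_eq_iff)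
  then have "the_inv_into {0..} psi (psi t) = t" using assms by (simp add: the_inv_into_f_f)
  then show ?thesis using psi_range[OF assms] by (simp add: transport_def)
qed

lemma transport_1: "transport h 1 = 1"
  by (simp add: transport_def)

lemma transport_extensional: "transport h \<in> extensional {0..1}"
  by (simp add: transport_def)

lemma one_01: "(1::real) \<in> {0..1}"
  by simp

lemma psi_01: "0 \<le> t \<Longrightarrow> psi t \<in> {0..1}"
  using psi_range[of t] by auto

lemma psi_cases:
  assumes "y \<in> {0..1}"
  obtains "y = 1" | t where "0 \<le> t" "y = psi t"
proof (cases "y = 1")
  case False
  then have "0 \<le> y" "y < 1" using assms by auto
  then obtain t where "0 \<le> t" "psi t = y" by (rule psi_surj)
  then show thesis using that(2) by blast
qed (rule that(1))

lemma transport_eqI: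
  assumes "f \<in> extensional {0..1}" "f 1 = 1" "\<And>t. 0 \<le> t \<Longrightarrow> f (psi t) = psi (h t)"
  shows "f = transport h"
proof (rule extensionalityI[OF assms(1) transport_extensional])
  fix y :: real assume "y \<in> {0..1}"
  then show "f y = transport h y"
    by (cases y rule: psi_cases) (simp_all add: assms transport_1 transport_psi)
qed

lemma transport_homeo:
  assumes mono: "strict_mono_on {0..} h" and surj: "h ` {0..} = {0..}"
  shows "transport h \<in> homeo_plus"
proof -
  have nonneg: "0 \<le> h t" if "0 \<le> t" for t using that surj by auto
  have less: "transport h y < transport h z" if y: "y \<in> {0..1}" and z: "z \<in> {0..1}" and "y < z" for y z
    using z
  proof (cases z rule: psi_cases)
    case 1
    with y \<open>y < z\<close> obtain t where "0 \<le> t" "y = psi t" by (cases y rule: psi_cases) auto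
    then show ?thesis using 1 nonneg psi_range by (simp add: transport_1 transport_psi)
  next
    case (2 t)
    with y \<open>y < z\<close> psi_range[of t] obtain s where s: "0 \<le> s" "y = psi s"
      by (cases y rule: psi_cases) auto
    then have "h s < h t"
      using \<open>y < z\<close> 2 mono by (auto simp: psi_less_iff strict_mono_on_def)
    then show ?thesis using 2 s nonneg by (simp add: transport_psi psi_less_iff)
  qed
  then have smono: "strict_mono_on {0..1} (transport h)" by (auto simp: strict_mono_on_def)
  have range: "transport h y \<in> {0..1}" if "y \<in> {0..1}" for y
    using that by (cases y rule: psi_cases) (auto simp: one_01 transport_1 transport_psi simp del: atLeastAtMost_iff intro: psi_01 nonneg)
  have onto: "z \<in> transport h ` {0..1}" if "z \<in> {0..1}" for z
    using that
  proof (cases z rule: psi_cases)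
    case 1
    then show ?thesis using transport_1[of h] by force
  next
    case (2 t)
    then obtain s where "0 \<le> s" "h s = t" using surj by (metis atLeast_iff imageE)
    then have "z = transport h (psi s)" using 2 by (simp add: transport_psi)
    then show ?thesis using psi_01[OF \<open>0 \<le> s\<close>] by blast
  qed
  have "inj_on (transport h) {0..1}" using smono by (rule strict_mono_on_imp_inj_on)
  then have "bij_betw (transport h) {0..1} {0..1}"
    using range onto by (auto simp: bij_betw_def)
  then show ?thesis
    using smono by (simp add: homeo_plus_iff Bij_def transport_extensional)
qed

lemma transport_mult:
  assumes g: "transport g \<in> Bij {0..1}" and h: "transport h \<in> Bij {0..1}"
    and "\<And>t. 0 \<le> t \<Longrightarrow> 0 \<le> h t" "\<And>t. 0 \<le> t \<Longrightarrow> f t = g (h t)"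
  shows "transport f = transport g \<otimes>\<^bsub>bij01\<^esub> transport h"
proof (rule transport_eqI[symmetric])
  show "transport g \<otimes>\<^bsub>bij01\<^esub> transport h \<in> extensional {0..1}"
    using mult_Bij[OF g h] by (rule Bij_imp_extensional)
qed (use assms psi_01 in \<open>simp_all add: mult_apply one_01 transport_1 transport_psi del: atLeastAtMost_iff\<close>)

lemma transport_id: "(\<And>t. 0 \<le> t \<Longrightarrow> h t = t) \<Longrightarrow> transport h = \<one>\<^bsub>bij01\<^esub>"
  by (rule transport_eqI[symmetric]) (auto simp: BijGroup_def one_01 psi_01 simp del: atLeastAtMost_iff)

definition stretch :: "real \<Rightarrow> real \<Rightarrow> real \<Rightarrow> real \<Rightarrow> real" where
  "stretch n r K t = (if t \<le> n then t else if t \<le> n + r then n + K * (t - n) else t + r * (K - 1))"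

lemma stretch_ge:
  assumes "0 \<le> r" "1 \<le> K"
  shows "t \<le> stretch n r K t"
proof -
  have "0 \<le> r * (K - 1)" using assms by simp
  moreover have "t - n \<le> K * (t - n)" if "n \<le> t"
    using assms that mult_right_mono[of 1 K "t - n"] by simp
  ultimately show ?thesis
    by (simp only: stretch_def split: if_split) (intro conjI impI; linarith)
qed

lemma stretch_less:
  assumes "0 \<le> r" "1 \<le> K" "s < t"
  shows "stretch n r K s < stretch n r K t"
proof (cases "t \<le> n + r")
  case True
  show ?thesis
  proof (cases "s \<le> n")
    case s: True
    have "s < n + K * (t - n)" if "n < t"
    proof -
      have "0 < K * (t - n)" using assms that by simp
      then show ?thesis using s by linarith
    qed
    then show ?thesis using True s assms by (auto simp: stretch_def)
  next
    case s: False
    have "K * (s - n) < K * (t - n)" using assms by simp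
    then show ?thesis using True s assms by (simp add: stretch_def)
  qed
next
  case False
  have "stretch n r K s \<le> s + r * (K - 1)"
  proof -
    have "0 \<le> r * (K - 1)" using assms by simp
    moreover have "(s - n) * (K - 1) \<le> r * (K - 1)" if "s \<le> n + r"
      using assms that by (intro mult_right_mono) auto
    ultimately show ?thesis by (auto simp: stretch_def algebra_simps)
  qed
  then show ?thesis using False assms by (simp add: stretch_def)
qed

lemma stretch_surj:
  assumes "0 \<le> n" "0 \<le> r" "1 \<le> K"
  shows "stretch n r K ` {0..} = {0..}"
proof (intro equalityI subsetI)
  fix u assume "u \<in> stretch n r K ` {0..}"
  then show "u \<in> {0..}" using stretch_ge[OF assms(2,3)] by (force intro: order_trans)
next
  fix u :: real assume u: "u \<in> {0..}"
  consider "u \<le> n" | "n < u" "u \<le> n + K * r" | "n + K * r < u" by linarith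
  then show "u \<in> stretch n r K ` {0..}"
  proof cases
    case 1
    then show ?thesis using u by (intro image_eqI[of _ _ u]) (auto simp: stretch_def)
  next
    case 2
    have "(u - n) / K \<le> r" "0 < (u - n) / K" using 2 assms by (simp_all add: field_simps)
    then show ?thesis using 2 assms u
      by (intro image_eqI[of _ _ "n + (u - n) / K"]) (auto simp: stretch_def divide_le_0_iff)
  next
    case 3
    have "n + r < u - r * (K - 1)" using 3 by (simp add: algebra_simps)
    then show ?thesis using 3 assms u
      by (intro image_eqI[of _ _ "u - r * (K - 1)"]) (auto simp: stretch_def)
  qed
qed

lemma transport_stretch_homeo:
  assumes "0 \<le> n" "0 \<le> r" "1 \<le> K"
  shows "transport (stretch n r K) \<in> homeo_plus"
  using stretch_surj[OF assms] stretch_less[OF assms(2,3)]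
  by (intro transport_homeo) (auto simp: strict_mono_on_def)

text \<open>
  Stretching the last unit first leaves the others in place, and stretching a unit by 4 produces four
  units. So all stretches of units by powers of 4 are products of stretches of single units by 4.
\<close>

lemma stretch_Suc:
  assumes "0 \<le> r" "1 \<le> K"
  shows "stretch n (r + 1) K t = stretch n r K (stretch (n + r) 1 K t)"
proof (cases "t \<le> n + r")
  case True
  then show ?thesis using assms by (auto simp: stretch_def)
next
  case False
  have "t \<le> stretch (n + r) 1 K t" using assms by (intro stretch_ge) auto
  then show ?thesis using False assms by (auto simp: stretch_def algebra_simps)
qed

lemma stretch_mult:
  assumes "1 \<le> K"
  shows "stretch n 1 (4 * K) t = stretch n 4 K (stretch n 1 4 t)"
  using assms by (auto simp: stretch_def algebra_simps)

definition caret :: "nat \<Rightarrow> real \<Rightarrow> real" where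
  "caret i = transport (stretch (real i) 1 4)"

lemma caret_homeo: "caret i \<in> homeo_plus"
  unfolding caret_def by (intro transport_stretch_homeo) auto

lemma stretch_relation:
  assumes "i + 1 \<le> j"
  shows "stretch i 1 4 (stretch j 1 4 t) = stretch (j + 3) 1 4 (stretch i 1 4 t)"
  using assms by (auto simp: stretch_def)

lemma caret_family_caret: "caret_family bij01 caret"
proof unfold_locales
  have Bij: "transport (stretch (real i) 1 4) \<in> Bij {0..1}" for i
    using caret_homeo[of i] by (simp add: caret_def homeo_plus_Bij)
  then show "caret i \<in> carrier bij01" for i by (simp add: caret_def carrier_bij01)
  fix i j :: nat assume "i < j"
  have nonneg: "0 \<le> stretch (real k) 1 4 t" if "0 \<le> t" for k t
    using that stretch_ge[of 1 4 t "real k"] by simp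
  have "caret i \<otimes>\<^bsub>bij01\<^esub> caret j = transport (\<lambda>t. stretch i 1 4 (stretch j 1 4 t))"
    unfolding caret_def by (intro transport_mult[symmetric] Bij nonneg) auto
  also have "\<dots> = transport (\<lambda>t. stretch (j + 3) 1 4 (stretch i 1 4 t))"
    using \<open>i < j\<close> stretch_relation[of "real i" "real j"] by (simp add: add.commute)
  also have "\<dots> = caret (j + 3) \<otimes>\<^bsub>bij01\<^esub> caret i"
    unfolding caret_def by (intro transport_mult Bij nonneg) auto
  finally show "caret i \<otimes>\<^bsub>bij01\<^esub> caret j = caret (j + 3) \<otimes>\<^bsub>bij01\<^esub> caret i" .
qed

text \<open>
  The map \<open>caret i\<close> moves the right end of unit \<open>i\<close>, which later carets fix.
\<close>

lemma separates_caret: "separates_normal_forms bij01 caret"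
proof (rule separates_normal_formsI[OF caret_family_caret])
  show "t \<le> caret i t" if "t \<in> {0..1}" for i t
    using that
  proof (cases t rule: psi_cases)
    case (2 s)
    then have "s \<le> stretch (real i) 1 4 s" by (intro stretch_ge) auto
    then show ?thesis using 2 by (simp add: caret_def transport_psi psi_le_iff)
  qed (simp add: caret_def transport_1)
  show "psi (real i + 1) \<in> {0..1}" for i by (rule psi_01) simp
  show "psi (real i + 1) < caret i (psi (real i + 1))" for i
    by (simp add: caret_def transport_psi stretch_def psi_less_iff)
  show "caret j (psi (real i + 1)) = psi (real i + 1)" if "i < j" for i j
    using that by (simp add: caret_def transport_psi stretch_def)
qed

section \<open>The carets generate the Thompson group\<close>

lemma caret_carrier: "range caret \<subseteq> carrier bij01"
  using caret_homeo homeo_plus_Bij by (auto simp: carrier_bij01)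

lemma subgroup_carets: "subgroup (generate bij01 (range caret)) bij01"
  using caret_carrier by (rule bij01.generate_is_subgroup)

lemma carets_Bij: "g \<in> generate bij01 (range caret) \<Longrightarrow> g \<in> Bij {0..1}"
  using subgroup.subset[OF subgroup_carets] by (auto simp: carrier_bij01)

lemma stretch_generated:
  "transport (stretch (real n) (real r) (4 ^ k)) \<in> generate bij01 (range caret)"
proof (induction k arbitrary: n r)
  case 0
  have "transport (stretch (real n) (real r) (4 ^ 0)) = \<one>\<^bsub>bij01\<^esub>"
    by (rule transport_id) (simp add: stretch_def)
  then show ?case by (simp only: generate.one)
next
  case (Suc k)
  let ?K = "4 ^ Suc k :: real"
  have K: "1 \<le> (4::real) ^ k" "1 \<le> ?K" by (rule one_le_power, simp)+
  have nonneg: "0 \<le> stretch m 1 K t" if "0 \<le> t" "1 \<le> K" for m K t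
    using that stretch_ge[of 1 K t m] by simp
  have unit: "transport (stretch (real m) 1 ?K) \<in> generate bij01 (range caret)" for m
  proof -
    have 4: "transport (stretch (real m) 4 (4 ^ k)) \<in> generate bij01 (range caret)"
      using Suc.IH[of m 4] by simp
    have c: "transport (stretch (real m) 1 4) \<in> generate bij01 (range caret)"
      by (auto intro!: generate.incl simp flip: caret_def)
    have "transport (stretch (real m) 1 ?K) =
        transport (stretch (real m) 4 (4 ^ k)) \<otimes>\<^bsub>bij01\<^esub> transport (stretch (real m) 1 4)"
      using stretch_mult[OF K(1)]
      by (intro transport_mult carets_Bij 4 c nonneg) simp_all
    then show ?thesis using 4 c by (simp only: generate.eng)
  qed
  show ?case
  proof (induction r)
    case 0
    have "transport (stretch (real n) (real 0) ?K) = \<one>\<^bsub>bij01\<^esub>"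
      by (rule transport_id) (simp add: stretch_def)
    then show ?case by (simp only: generate.one)
  next
    case (Suc r)
    have u: "transport (stretch (real n + real r) 1 ?K) \<in> generate bij01 (range caret)"
      using unit[of "n + r"] by (simp only: of_nat_add)
    have "transport (stretch (real n) (real (Suc r)) ?K) =
        transport (stretch (real n) (real r) ?K) \<otimes>\<^bsub>bij01\<^esub> transport (stretch (real n + real r) 1 ?K)"
    proof (intro transport_mult carets_Bij Suc u nonneg K)
      show "stretch (real n) (real (Suc r)) ?K t =
          stretch (real n) (real r) ?K (stretch (real n + real r) 1 ?K t)" for t
        using stretch_Suc[of "real r" ?K "real n" t] K(2) by (simp only: of_nat_Suc add.commute)
    qed
    then show ?case using Suc u by (simp only: generate.eng)
  qed
qed

text \<open>
  Peeling off the last unit: stretch it to its final length first and then apply the map that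
  differs from \<open>h\<close> only in being a translation from \<open>J\<close> on.
\<close>

lemma integral_generated:
  fixes k :: "nat \<Rightarrow> nat"
  assumes "h 0 = 0"
    and "\<And>j s. j < J \<Longrightarrow> 0 \<le> s \<Longrightarrow> s \<le> 1 \<Longrightarrow> h (real j + s) = h (real j) + 4 ^ k j * s"
    and "\<And>t. real J \<le> t \<Longrightarrow> h t = h (real J) + (t - real J)"
  shows "transport h \<in> generate bij01 (range caret)"
  using assms
proof (induction J arbitrary: h)
  case 0
  have "h t = t" if "0 \<le> t" for t using 0(1) 0(3)[of t] that by simp
  then have "transport h = \<one>\<^bsub>bij01\<^esub>" by (rule transport_id)
  then show ?case by (simp only: generate.one)
next
  case (Suc J)
  define h' where "h' t = (if t \<le> real J then h t else h (real J) + (t - real J))" for t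
  have h': "transport h' \<in> generate bij01 (range caret)"
  proof (rule Suc.IH)
    show "h' (real j + s) = h' (real j) + 4 ^ k j * s" if "j < J" "0 \<le> s" "s \<le> 1" for j s
    proof -
      have "real j + 1 \<le> real J" using that by simp
      then show ?thesis using Suc.prems(2)[of j s] that by (simp add: h'_def)
    qed
  qed (use Suc.prems(1) in \<open>auto simp: h'_def\<close>)
  let ?K = "4 ^ k J :: real"
  have K: "1 \<le> ?K" by (simp add: one_le_power)
  have s: "transport (stretch (real J) 1 ?K) \<in> generate bij01 (range caret)"
    using stretch_generated[of J 1 "k J"] by simp
  have "transport h = transport h' \<otimes>\<^bsub>bij01\<^esub> transport (stretch (real J) 1 ?K)"
  proof (intro transport_mult carets_Bij h' s)
    fix t :: real assume t: "0 \<le> t"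
    show "0 \<le> stretch (real J) 1 ?K t" using stretch_ge[of 1 ?K t "real J"] K t by simp
    have step: "h (real J + s) = h (real J) + ?K * s" if "0 \<le> s" "s \<le> 1" for s
      using Suc.prems(2)[of J s] that by simp
    consider "t \<le> real J" | "real J < t" "t \<le> real J + 1" | "real J + 1 < t" by linarith
    then show "h t = h' (stretch (real J) 1 ?K t)"
    proof cases
      case 1
      then show ?thesis by (simp add: stretch_def h'_def)
    next
      case 2
      then have "\<not> real J + ?K * (t - real J) \<le> real J" by (simp add: not_le)
      then show ?thesis using 2 step[of "t - real J"] by (simp add: stretch_def h'_def)
    next
      case 3
      have "h t = h (real J) + ?K * 1 + (t - (real J + 1))"
        using Suc.prems(3)[of t] step[of 1] 3 by (simp add: add.commute)
      moreover have "\<not> t + (K - 1) \<le> real J" if "1 \<le> K" for K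
        using 3 that by simp
      then have "\<not> t + (?K - 1) \<le> real J" using K by blast
      ultimately show ?thesis using 3 by (simp add: stretch_def h'_def)
    qed
  qed
  then show ?case using h' s by (simp only: generate.eng)
qed

text \<open>
  The change of coordinates from the chart \<open>psi\<close> to the uniform coordinate \<open>4 ^ m * y\<close> on
  \<open>[0, 1 - 1/4^q]\<close>, continued by a translation. If \<open>q \<le> m\<close>, it stretches each unit by a power of 4
  that is at least 1.
\<close>

definition uniformize :: "nat \<Rightarrow> nat \<Rightarrow> real \<Rightarrow> real" where
  "uniformize q m t = (if t \<le> 3 * real q then 4 ^ m * psi t
     else 4 ^ m * (1 - 1 / 4 ^ q) + (t - 3 * real q))"

lemma uniformize_generated:
  assumes "q \<le> m"
  shows "transport (uniformize q m) \<in> generate bij01 (range caret)"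
proof (rule integral_generated[where J = "3 * q" and k = "\<lambda>j. m - (j div 3 + 1)"])
  show "uniformize q m 0 = 0" by (simp add: uniformize_def)
  show "uniformize q m (real j + s) = uniformize q m (real j) + 4 ^ (m - (j div 3 + 1)) * s"
    if "j < 3 * q" "0 \<le> s" "s \<le> 1" for j s
  proof -
    have "j div 3 + 1 \<le> m" using that(1) assms by linarith
    then have "(4::real) ^ m = 4 ^ (m - (j div 3 + 1)) * 4 ^ (j div 3 + 1)"
      by (metis le_add_diff_inverse2 power_add)
    then have "4 ^ m * (s / 4 ^ (j div 3 + 1)) = 4 ^ (m - (j div 3 + 1)) * s" by simp
    moreover have "real j + 1 \<le> 3 * real q" using that(1) by linarith
    ultimately show ?thesis
      using that psi_unit[of s j] by (simp add: uniformize_def distrib_left)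
  qed
  show "uniformize q m t = uniformize q m (real (3 * q)) + (t - real (3 * q))" if "real (3 * q) \<le> t" for t
    using that by (cases "t = 3 * real q") (simp_all add: uniformize_def psi_triple)
qed

text \<open>
  Choose \<open>q\<close> and \<open>q'\<close> such that \<open>g\<close> maps \<open>[1 - 1/4^q, 1]\<close> affinely onto \<open>[1 - 1/4^q', 1]\<close>; in the
  chart this is a translation. To the left of it the uniform coordinates \<open>4^q * y\<close> and
  \<open>4^m' * y\<close> turn \<open>g\<close> into a map that is affine on units with slopes \<open>4 ^ k\<close>, and \<open>m'\<close> is taken so
  large that no \<open>k\<close> is negative. The resulting map \<open>w\<close> is generated by carets, hence so is \<open>g\<close>.
\<close>

theorem thompson_subset_generated: "thompson_F4_set \<subseteq> generate bij01 (range caret)"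
proof
  fix g assume g: "g \<in> thompson_F4_set"
  then have homeo: "g \<in> homeo_plus" by (rule thompson_homeo)
  then have Bij: "g \<in> Bij {0..1}" by (rule homeo_plus_Bij)
  note ends = homeo_plus_endpoints[OF homeo]
  obtain m where m: "\<And>n j. m \<le> n \<Longrightarrow> j < 4 ^ n \<Longrightarrow>
      \<exists>(k::int) c. \<forall>x\<in>{real j / 4 ^ n..(real j + 1) / 4 ^ n}. g x = 4 powi k * x + c"
    using thompson_mesh[OF g] by blast
  obtain \<kappa> :: int where \<kappa>: "\<And>y. 1 - 1 / 4 ^ m \<le> y \<Longrightarrow> y \<le> 1 \<Longrightarrow> g y = 1 - 4 powi \<kappa> * (1 - y)"
  proof -
    obtain \<kappa> c where kc: "\<forall>x\<in>{real (4 ^ m - 1) / 4 ^ m..(real (4 ^ m - 1) + 1) / 4 ^ m}. g x = 4 powi (\<kappa>::int) * x + c"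
      using m[of m "4 ^ m - 1"] by auto
    have "real (4 ^ m - 1) / 4 ^ m = 1 - 1 / 4 ^ m" "(real (4 ^ m - 1) + 1) / 4 ^ m = 1"
      by (simp_all add: of_nat_diff diff_divide_distrib)
    then have kc: "g x = 4 powi \<kappa> * x + c" if "1 - 1 / 4 ^ m \<le> x" "x \<le> 1" for x
      using kc that by simp
    have "c = 1 - 4 powi \<kappa>" using kc[of 1] ends by simp
    then have "g y = 1 - 4 powi \<kappa> * (1 - y)" if "1 - 1 / 4 ^ m \<le> y" "y \<le> 1" for y
      using kc[OF that] by (simp add: algebra_simps)
    then show thesis using that by blast
  qed
  \<comment> \<open>The slope at 1 may exceed 1, and then \<open>q\<close> has to be at least \<open>\<kappa>\<close> for \<open>q' = q - \<kappa>\<close> to be a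
    natural number.\<close>
  define q where "q = max m (nat \<kappa>)"
  define q' where "q' = nat (int q - \<kappa>)"
  have q: "m \<le> q" "\<kappa> \<le> int q" by (auto simp: q_def)
  have slope: "4 powi \<kappa> / 4 ^ q = 1 / (4::real) ^ q'"
  proof -
    have "(4::real) powi \<kappa> * 4 ^ q' = 4 powi (\<kappa> + int q')" by (simp add: power_int_add)
    also have "\<dots> = 4 ^ q" using q by (simp add: q'_def)
    finally show ?thesis by (simp add: field_simps)
  qed
  have near1: "g (1 - u / 4 ^ q) = 1 - u / 4 ^ q'" if "0 \<le> u" "u \<le> 1" for u
  proof -
    have "(4::real) ^ m \<le> 4 ^ q" using q by (intro power_increasing) auto
    then have "u / 4 ^ q \<le> 1 / 4 ^ m" using that by (intro frac_le) auto
    then have "g (1 - u / 4 ^ q) = 1 - 4 powi \<kappa> * (u / 4 ^ q)"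
      using \<kappa>[of "1 - u / 4 ^ q"] that by simp
    also have "4 powi \<kappa> * (u / 4 ^ q) = u * (4 powi \<kappa> / 4 ^ q)" by simp
    finally show ?thesis by (simp only: slope) simp
  qed
  obtain k :: "nat \<Rightarrow> int" and c where k: "\<And>j x. j < 4 ^ q \<Longrightarrow>
      x \<in> {real j / 4 ^ q..(real j + 1) / 4 ^ q} \<Longrightarrow> g x = 4 powi k j * x + c j"
    using m[OF q(1)] by metis
  \<comment> \<open>The summand \<open>M\<close> of \<open>m'\<close> compensates for the negative slope exponents of \<open>g\<close>.\<close>
  define M where "M = (\<Sum>j<4 ^ q. nat (- k j))"
  have M: "- k j \<le> int M" if "j < 4 ^ q" for j
  proof -
    have "nat (- k j) \<le> M" unfolding M_def using that by (intro member_le_sum) auto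
    then show ?thesis by linarith
  qed
  define m' where "m' = q' + q + M"
  define J where "J = (4::nat) ^ q - 1"
  have J: "real J = 4 ^ q - 1" by (simp add: J_def of_nat_diff)
  then have J': "real J / 4 ^ q = 1 - 1 / 4 ^ q" by (simp add: diff_divide_distrib)
  define w where "w t = (if t \<le> real J then 4 ^ m' * g (t / 4 ^ q)
    else 4 ^ m' * (1 - 1 / 4 ^ q') + (t - real J))" for t
  have w: "transport w \<in> generate bij01 (range caret)"
  proof (rule integral_generated[where J = J and k = "\<lambda>j. nat (int m' - int q + k j)"])
    show "w 0 = 0" using ends by (simp add: w_def)
    show "w (real j + s) = w (real j) + 4 ^ nat (int m' - int q + k j) * s"
      if "j < J" "0 \<le> s" "s \<le> 1" for j s
    proof -
      have j: "j < 4 ^ q" "real j + 1 \<le> real J" using that(1) unfolding J_def by linarith+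
      have "0 \<le> int m' - int q + k j" using M[OF j(1)] by (simp add: m'_def)
      then have "(4::real) ^ nat (int m' - int q + k j) = 4 powi (int m' - int q + k j)"
        by (simp add: power_int_def)
      also have "\<dots> = 4 ^ m' * 4 powi k j / 4 ^ q"
        by (simp add: power_int_add power_int_diff)
      finally have pow: "(4::real) ^ nat (int m' - int q + k j) = 4 ^ m' * 4 powi k j / 4 ^ q" .
      have "(real j + s) / 4 ^ q \<in> {real j / 4 ^ q..(real j + 1) / 4 ^ q}"
        "real j / 4 ^ q \<in> {real j / 4 ^ q..(real j + 1) / 4 ^ q}"
        using that by (auto simp: divide_right_mono)
      note this[THEN k[OF j(1)]]
      then have "4 ^ m' * g ((real j + s) / 4 ^ q) = 4 ^ m' * g (real j / 4 ^ q) + 4 ^ m' * 4 powi k j / 4 ^ q * s"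
        by (simp add: add_divide_distrib distrib_left)
      then show ?thesis using that j by (simp add: w_def pow)
    qed
    show "w t = w (real J) + (t - real J)" if "real J \<le> t" for t
      using that near1[of 1] by (cases "t = real J") (simp_all add: w_def J')
  qed
  have D: "transport (uniformize q q) \<in> generate bij01 (range caret)"
    and D': "transport (uniformize q' m') \<in> generate bij01 (range caret)"
    by (auto intro: uniformize_generated simp: m'_def)
  note Bijs = Bij D[THEN carets_Bij] D'[THEN carets_Bij] w[THEN carets_Bij]
  have "transport (uniformize q' m') \<otimes>\<^bsub>bij01\<^esub> g = transport w \<otimes>\<^bsub>bij01\<^esub> transport (uniformize q q)"
  proof (rule Bij01_eqI)
    fix y :: real assume y: "y \<in> {0..1}"
    have "transport (uniformize q' m') (g y) = transport w (transport (uniformize q q) y)"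
      using y
    proof (cases y rule: psi_cases)
      case 1
      then show ?thesis using ends by (simp add: transport_1)
    next
      case (2 t)
      show ?thesis
      proof (cases "t \<le> 3 * real q")
        case True
        then have le: "psi t \<le> 1 - 1 / 4 ^ q"
          using 2 psi_le_iff[of t "3 * real q"] by (simp add: psi_triple)
        then have "g (psi t) \<le> g (1 - 1 / 4 ^ q)"
          using homeo y 2 by (subst homeo_plus_le_iff) auto
        then have le': "g (psi t) \<le> psi (3 * real q')" using near1[of 1] by (simp add: psi_triple)
        then have "g (psi t) < 1" using psi_range[of "3 * real q'"] by simp
        moreover have "0 \<le> g (psi t)" using Bij01_range[OF Bij y] 2 by simp
        ultimately obtain t' where t': "0 \<le> t'" "psi t' = g (psi t)" using psi_surj by metis
        then have "t' \<le> 3 * real q'" using le' psi_le_iff[of t' "3 * real q'"] by simp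
        then have "uniformize q' m' t' = 4 ^ m' * g (psi t)" using t' by (simp add: uniformize_def)
        then have lhs: "transport (uniformize q' m') (g y) = psi (4 ^ m' * g (psi t))"
          using transport_psi[OF t'(1), of "uniformize q' m'"] unfolding t'(2) 2(2) by simp
        have u: "uniformize q q t = 4 ^ q * psi t" using True by (simp add: uniformize_def)
        have "4 ^ q * psi t \<le> real J"
          using le unfolding J by (simp add: field_simps)
        then have "w (uniformize q q t) = 4 ^ m' * g (psi t)" by (simp add: u w_def)
        moreover have "0 \<le> uniformize q q t" using psi_range(1)[OF 2(1)] by (simp add: u)
        ultimately show ?thesis
          unfolding lhs unfolding 2(2) transport_psi[OF 2(1)] by (simp add: transport_psi)
      next
        case False
        define s where "s = t - 3 * real q"
        then have s: "0 < s" "t = s + 3 * real q" using False by simp_all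
        have "psi t = 1 - (1 - psi s) / 4 ^ q" using s by (simp add: psi_shift)
        then have "g (psi t) = 1 - (1 - psi s) / 4 ^ q'"
          using near1[of "1 - psi s"] psi_range[of s] s by simp
        also have "\<dots> = psi (s + 3 * real q')" using s by (simp add: psi_shift)
        finally have "transport (uniformize q' m') (g y) = psi (4 ^ m' * (1 - 1 / 4 ^ q') + s)"
          using 2 s by (simp add: transport_psi uniformize_def)
        moreover have "uniformize q q t = real J + s"
          using s by (simp add: uniformize_def J right_diff_distrib)
        ultimately show ?thesis
          using 2 s by (simp add: transport_psi w_def)
      qed
    qed
    then show "(transport (uniformize q' m') \<otimes>\<^bsub>bij01\<^esub> g) y = (transport w \<otimes>\<^bsub>bij01\<^esub> transport (uniformize q q)) y"
      using y Bijs by (simp add: mult_apply)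
  qed (auto intro: mult_Bij Bijs)
  then have "g = inv\<^bsub>bij01\<^esub> transport (uniformize q' m') \<otimes>\<^bsub>bij01\<^esub> (transport w \<otimes>\<^bsub>bij01\<^esub> transport (uniformize q q))"
    using Bijs by (simp add: carrier_bij01 mult_Bij bij01.inv_solve_left)
  moreover have "inv\<^bsub>bij01\<^esub> transport (uniformize q' m') \<otimes>\<^bsub>bij01\<^esub> (transport w \<otimes>\<^bsub>bij01\<^esub> transport (uniformize q q)) \<in> generate bij01 (range caret)"
    by (intro subgroup.m_closed[OF subgroup_carets] subgroup.m_inv_closed[OF subgroup_carets] D D' w)
  ultimately show "g \<in> generate bij01 (range caret)" by (simp only:)
qed

lemma psi_Z_quarter: "psi (real n) \<in> Z_quarter"
proof (induction n)
  case 0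
  then show ?case using Z_quarter_dyadic[of 0 0] by simp
next
  case (Suc n)
  then show ?case
    using psi_unit[of 1 n] Z_quarter_add[OF Suc Z_quarter_dyadic[of 1 "n div 3 + 1"]]
    by (simp add: add.commute)
qed

text \<open>
  The breakpoints are the quarters of unit \<open>i\<close>. The chart is affine on each quarter, but the four
  units onto which the quarters are mapped can lie in two blocks of different scale.
\<close>

lemma caret_thompson: "caret i \<in> thompson_F4_set"
proof (rule thompsonI[where B = "(\<lambda>j. psi (real i + real j / 4)) ` {..4}"])
  show "caret i \<in> homeo_plus" by (rule caret_homeo)
  let ?P = "\<lambda>j::nat. psi (real i + real j / 4)"
  have P: "?P j = psi (real i) + real j / 4 ^ (i div 3 + 2)" if "j \<le> 4" for j
    using psi_unit[of "real j / 4" i] that by simp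
  show "?P ` {..4} \<subseteq> Z_quarter"
    by (auto simp only: P atMost_iff intro!: Z_quarter_add psi_Z_quarter Z_quarter_dyadic)
  fix a b :: real assume ab: "0 \<le> a" "a < b" "b \<le> 1" and "{a<..<b} \<inter> ?P ` {..4} = {}"
  then have avoid: "?P j \<le> a \<or> b \<le> ?P j" if "j \<le> 4" for j
    using that by (force simp: not_le)
  have "\<exists>j<4. ?P j \<le> a \<and> b \<le> ?P (Suc j)" if "?P 0 \<le> a" "b \<le> ?P 4"
  proof (rule ccontr)
    assume none: "\<not> ?thesis"
    have "?P j \<le> a" if "j \<le> 4" for j
      using that
    proof (induction j)
      case (Suc j)
      then show ?case using none avoid[of "Suc j"] by (meson Suc_leD Suc_le_lessD)
    qed (rule \<open>?P 0 \<le> a\<close>)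
    then show False using that(2) ab(2) by (meson le_refl not_le order_trans)
  qed
  then consider "b \<le> ?P 0" | "?P 4 \<le> a" | j where "j < 4" "?P j \<le> a" "b \<le> ?P (Suc j)"
    using avoid[of 0] avoid[of 4] by blast
  then show "\<exists>(k::int) c. \<forall>x\<in>{a..b}. caret i x = 4 powi k * x + c"
  proof cases
    case 1
    have "caret i x = 4 powi 0 * x + 0" if "x \<in> {a..b}" for x
    proof -
      have "x \<in> {0..1}" "x \<le> psi (real i)" using that 1 ab by auto
      then show ?thesis
        using psi_range[of "real i"]
        by (cases x rule: psi_cases) (auto simp: caret_def transport_psi psi_le_iff stretch_def)
    qed
    then show ?thesis by blast
  next
    case 2
    have "caret i x = 4 powi (-1) * x + 3 / 4" if "x \<in> {a..b}" for x
    proof -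
      have "x \<in> {0..1}" "psi (real i + 1) \<le> x" using that 2 ab by auto
      then show ?thesis
      proof (cases x rule: psi_cases)
        case (2 t)
        then have "real i + 1 \<le> t" using \<open>psi (real i + 1) \<le> x\<close> by (simp add: psi_le_iff)
        then have "stretch (real i) 1 4 t = t + 3 * real 1"
          by (cases "t = real i + 1") (auto simp: stretch_def)
        then show ?thesis using 2 psi_shift[of t 1] by (simp add: caret_def transport_psi field_simps)
      qed (simp add: caret_def transport_1)
    qed
    then show ?thesis by blast
  next
    case (3 j)
    let ?p = "i div 3 + 1" and ?r = "(i + j) div 3 + 1"
    have "caret i x = 4 powi (1 + int ?p - int ?r) * x +
        (psi (real (i + j)) - (4 * 4 ^ ?p * psi (real i) + real j) / 4 ^ ?r)" if "x \<in> {a..b}" for x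
    proof -
      have x: "x \<in> {0..1}" "?P j \<le> x" "x \<le> ?P (Suc j)" using that 3 ab by auto
      then have "x \<noteq> 1" using psi_range[of "real i + real (Suc j) / 4"] by auto
      with x obtain t where t: "0 \<le> t" "x = psi t" by (cases x rule: psi_cases) auto
      then have "real i + real j / 4 \<le> t" "t \<le> real i + real (Suc j) / 4"
        using x by (simp_all add: psi_le_iff)
      moreover define s where "s = t - (real i + real j / 4)"
      ultimately have s: "0 \<le> s" "4 * s \<le> 1" "t = real i + (real j / 4 + s)" "real j / 4 + s \<le> 1"
        using 3 by (simp_all add: field_simps)
      have "stretch (real i) 1 4 t = real (i + j) + 4 * s"
        using s by (cases "t = real i") (auto simp: stretch_def)
      then have "caret i x = psi (real (i + j)) + 4 * s / 4 ^ ?r"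
        using t s psi_unit[of "4 * s" "i + j"] by (simp add: caret_def transport_psi)
      moreover have "x = psi (real i) + (real j / 4 + s) / 4 ^ ?p"
        using t s psi_unit[of "real j / 4 + s" i] by simp
      then have "4 * s = 4 * 4 ^ ?p * x - (4 * 4 ^ ?p * psi (real i) + real j)"
        by (simp add: field_simps)
      moreover have "(4::real) powi (1 + int p - int r) = 4 * 4 ^ p / 4 ^ r" for p r
        by (simp add: power_int_add power_int_diff)
      note this[of ?p ?r]
      ultimately show ?thesis by (simp add: diff_divide_distrib)
    qed
    then show ?thesis by blast
  qed
qed simp

theorem thompson_generated: "generate bij01 (range caret) = thompson_F4_set"
proof (rule antisym)
  show "generate bij01 (range caret) \<subseteq> thompson_F4_set"
    using caret_thompson by (intro bij01.generate_subgroup_incl subgroup_thompson) auto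
qed (rule thompson_subset_generated)

theorem theorem1p3:
  fixes f :: "nat \<Rightarrow> real \<Rightarrow> real" and L R :: "nat \<Rightarrow> real set"
  assumes "\<And>i. i \<in> {1..4} \<Longrightarrow> positive_bump (f i)"
    and "\<And>i. i \<in> {1..4} \<Longrightarrow> pair_of_feet (f i) (L i) (R i)"
    and "sorted_wrt disjnt [L 1, L 2, L 3, L 4, R 1, R 3, R 2, R 4]"
    and "sorted_wrt left_of [L 1, L 2, L 3, L 4, R 1, R 3, R 2, R 4]"
  shows "subgroup_generated (BijGroup {0..1}) (f ` {1..4}) \<cong> thompson_F4"
proof -
  obtain a2 a3 a4 b1 b2 b3 where "fast_bumps (f 1) (f 2) (f 3) (f 4) a2 a3 a4 b1 b2 b3"
    using fast_bumps_of_feet[OF assms(1,2,4)] by blast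
  then interpret fast_bumps "f 1" "f 2" "f 3" "f 4" a2 a3 a4 b1 b2 b3 .
  have "{1..4} = {1, 2, 3, 4 :: nat}" by auto
  then have image: "f ` {1..4} = {f 1, f 2, f 3, f 4}" by simp
  have "carrier bij01 \<inter> f ` {1..4} = {f 1, f 2, f 3, f 4}"
    unfolding image carrier_bij01 using Bij by blast
  moreover have "carrier bij01 \<inter> range (conj_extend base) = range (conj_extend base)"
    using caret_family.closed[OF caret_family] by blast
  ultimately have "subgroup_generated bij01 (f ` {1..4}) = subgroup_generated bij01 (range (conj_extend base))"
    by (simp only: subgroup_generated_def generate_eq)
  also have "\<dots> \<cong> subgroup_generated bij01 (range caret)"
    by (rule iso_caret_families[OF caret_family caret_family_caret separates separates_caret])
  also have "subgroup_generated bij01 (range caret) = thompson_F4"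
    using caret_carrier
    by (simp add: subgroup_generated_def thompson_F4_def Int_absorb1 thompson_generated)
  finally show ?thesis .
qed

end
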